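(* For each integer $n\geq 2$ there is a finite group $H$ such that \[ |\mathrm{Hom}(G_n(GK),H)| < |\mathrm{Hom}(G_n(SK),H)|, \] where $SK$ is the square knot, $GK$ is the granny knot, and $G_n(K)$ denotes the $n$th generalised knot group of a knot $K$. Consequently, $G_n(GK)$ is not isomorphic to $G_n(SK)$ for $n\geq 2$.
   Context: Generalised knot groups: for a knot $K\subset S^3$ and an integer $n\ge 1$, $G_n(K)$ is the fundamental group of the space obtained from the exterior of $K$ by gluing a torus $S^1\times S^1$ to the boundary torus via the map $f(z_1,z_2)=(z_1^n,z_2)$, where $z_1$ represents the meridian and $z_2$ the longitude. Equivalently, if $\pi_1(S^3\setminus K)=\langle g_1,\dots,g_m\mid r_1,\dots,r_p\rangle$ and $\mu,\lambda$ are words in the generators representing a meridian-longitude pair, then \[ G_n(K)=\langle g_1,\dots,g_m,\nu\mid r_1,\dots,r_p,\ \nu^n=\mu,\ \lambda\nu=\nu\lambda\rangle . \] (The longitude need not be $0$-framed: replacing $\lambda$ by $\lambda\mu^k$ gives the same group.) The granny knot $GK$ is the connected sum of two left-handed or two right-handed trefoils; the square knot $SK$ is the connected sum of a left-handed and a right-handed trefoil. Explicitly, with $x=ca$ and $w=fa$, \[ G_n(SK)\cong\langle a,c,f,\nu\mid aca=cac,\ afa=faf,\ \nu^n=a,\ x^3w^{-3}\nu=\nu x^3w^{-3}\rangle, \] \[ G_n(GK)\cong\langle a,c,f,\nu\mid aca=cac,\ afa=faf,\ \nu^n=a,\ x^3w^{3}\nu=\nu x^3w^{3}\rangle . \] $\mathrm{Hom}(G,H)$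 is the set of group homomorphisms $G\to H$. *)

theory Defs
  imports "HOL-Algebra.Group"
begin

section \<open>Group presentations\<close>

text \<open>A word is a list of letters: \<open>(g, Positive)\<close> stands for \<open>g\<close> and \<open>(g, Negative)\<close> for
  \<open>g\<^sup>-\<^sup>1\<close>.  A relation \<open>p = q\<close> is the pair \<open>(p, q)\<close>.\<close>

datatype sign = Positive | Negative

fun opposite :: "sign \<Rightarrow> sign" where
  "opposite Positive = Negative"
| "opposite Negative = Positive"

type_synonym 'g word = "('g \<times> sign) list"

definition words :: "'g set \<Rightarrow> 'g word set" where
  "words S = lists (S \<times> UNIV)"

definition power_word :: "'g \<Rightarrow> int \<Rightarrow> 'g word" where
  "power_word g k = replicate (nat \<bar>k\<bar>) (g, if k \<ge> 0 then Positive else Negative)"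

text \<open>The least congruence on the words over \<open>S\<close> that contains free cancellation and the
  relations \<open>R\<close>.\<close>

inductive_set word_eq :: "'g set \<Rightarrow> ('g word \<times> 'g word) set \<Rightarrow> ('g word \<times> 'g word) set"
  for S R where
  refl: "u \<in> words S \<Longrightarrow> (u, u) \<in> word_eq S R"
| sym: "(u, v) \<in> word_eq S R \<Longrightarrow> (v, u) \<in> word_eq S R"
| trans: "(u, v) \<in> word_eq S R \<Longrightarrow> (v, w) \<in> word_eq S R \<Longrightarrow> (u, w) \<in> word_eq S R"
| cancel: "u \<in> words S \<Longrightarrow> v \<in> words S \<Longrightarrow> g \<in> S \<Longrightarrow>
    (u @ [(g, s), (g, opposite s)] @ v, u @ v) \<in> word_eq S R"
| relation: "u \<in> words S \<Longrightarrow> v \<in> words S \<Longrightarrow> (p, q) \<in> R \<Longrightarrow> p \<in> words S \<Longrightarrow> q \<in> words S \<Longrightarrow>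
    (u @ p @ v, u @ q @ v) \<in> word_eq S R"

definition presented_group :: "'g set \<Rightarrow> ('g word \<times> 'g word) set \<Rightarrow> 'g word set monoid" where
  "presented_group S R =
     \<lparr>carrier = words S // word_eq S R,
      mult = (\<lambda>A B. \<Union>u\<in>A. \<Union>v\<in>B. word_eq S R `` {u @ v}),
      one = word_eq S R `` {[]}\<rparr>"


section \<open>Homomorphism sets\<close>

text \<open>The library's \<^const>\<open>hom\<close> does not constrain functions outside the carrier; restricting
  to extensional functions makes each homomorphism correspond to exactly one function, as needed
  for counting.\<close>

definition Hom :: "('a, 'c) monoid_scheme \<Rightarrow> ('b, 'd) monoid_scheme \<Rightarrow> ('a \<Rightarrow> 'b) set" where
  "Hom G H = hom G H \<inter> extensional (carrier G)"


section \<open>Knot diagrams and generalised knot groups\<close>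

text \<open>An oriented knot diagram is given by its signed Gauss code: starting at a base point and
  following the orientation, one lists the passages through the crossings, each with the label and
  the sign of the crossing.  Every crossing of a diagram occurs once as \<open>Over\<close> and once as
  \<open>Under\<close>, with the same sign.\<close>

datatype 'c passage =
    is_Over: Over (crossing: 'c) (crossing_sign: sign)
  | is_Under: Under (crossing: 'c) (crossing_sign: sign)

type_synonym 'c diagram = "'c passage list"

definition underpasses :: "'c diagram \<Rightarrow> 'c passage list" where
  "underpasses D = filter is_Under D"

text \<open>The arcs are numbered cyclically in the order of traversal, arc 0 containing the base
  point, so that underpass \<open>j\<close> leads from arc \<open>j\<close> to arc \<open>j + 1\<close>.  A diagram without crossings
  has one arc.\<close>

definition arc_count :: "'c diagram \<Rightarrow> nat" where
  "arc_count D = max 1 (length (underpasses D))"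

definition over_arc :: "'c diagram \<Rightarrow> 'c \<Rightarrow> nat" where
  "over_arc D c =
     length (underpasses (takeWhile (\<lambda>p. \<not> (is_Over p \<and> crossing p = c)) D)) mod arc_count D"

text \<open>The letter by which passing under a crossing conjugates: \<open>g\<^sub>k\<close> or \<open>g\<^sub>k\<^sup>-\<^sup>1\<close>, where \<open>k\<close> is
  the overcrossing arc, according to the sign of the crossing.\<close>

definition over_letter :: "'c diagram \<Rightarrow> 'c passage \<Rightarrow> nat \<times> sign" where
  "over_letter D p = (over_arc D (crossing p), crossing_sign p)"

text \<open>Wirtinger relation at underpass \<open>j\<close>: \<open>e g\<^sub>j\<^sub>+\<^sub>1 = g\<^sub>j e\<close> with \<open>e\<close> the letter above.\<close>

definition wirtinger_relations :: "'c diagram \<Rightarrow> (nat word \<times> nat word) set" where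
  "wirtinger_relations D =
     {([over_letter D (underpasses D ! j), (Suc j mod arc_count D, Positive)],
       [(j, Positive), over_letter D (underpasses D ! j)]) | j. j < length (underpasses D)}"

definition writhe :: "'c diagram \<Rightarrow> int" where
  "writhe D = (\<Sum>p\<leftarrow>underpasses D. case crossing_sign p of Positive \<Rightarrow> 1 | Negative \<Rightarrow> -1)"

definition meridian :: "'c diagram \<Rightarrow> nat word" where
  "meridian D = [(0, Positive)]"

text \<open>The 0-framed longitude belonging to this meridian: the blackboard longitude, corrected by
  the writhe.\<close>

definition longitude :: "'c diagram \<Rightarrow> nat word" where
  "longitude D = map (over_letter D) (underpasses D) @ power_word 0 (- writhe D)"

text \<open>Given a presentation \<open>\<langle>S | R\<rangle>\<close> of a knot group and words \<open>\<mu>\<close>, \<open>l\<close> for a meridian-longitude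
  pair, adjoin a new generator \<open>\<nu>\<close> (encoded as \<open>None\<close>) with \<open>\<nu>\<^sup>n = \<mu>\<close> and \<open>l \<nu> = \<nu> l\<close>.\<close>

definition adjoin_meridian_root ::
  "nat \<Rightarrow> 'g set \<Rightarrow> ('g word \<times> 'g word) set \<Rightarrow> 'g word \<Rightarrow> 'g word \<Rightarrow> 'g option word set monoid"
  where
  "adjoin_meridian_root n S R \<mu> l =
     (let emb = map (map_prod Some id); \<nu> = (None, Positive) in
      presented_group (insert None (Some ` S))
        (map_prod emb emb ` R \<union>
         {(replicate n \<nu>, emb \<mu>), (emb l @ [\<nu>], [\<nu>] @ emb l)}))"

definition generalised_knot_group :: "nat \<Rightarrow> 'c diagram \<Rightarrow> nat option word set monoid" where
  "generalised_knot_group n D =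
     adjoin_meridian_root n {..<arc_count D} (wirtinger_relations D) (meridian D) (longitude D)"


section \<open>The granny and square knots\<close>

text \<open>The standard diagram of the trefoil with three crossings of the same sign: right-handed if
  they are positive, left-handed if they are negative.\<close>

definition trefoil :: "sign \<Rightarrow> nat diagram" where
  "trefoil s = [Over 1 s, Under 2 s, Over 3 s, Under 1 s, Over 2 s, Under 3 s]"

abbreviation "right_trefoil \<equiv> trefoil Positive"
abbreviation "left_trefoil \<equiv> trefoil Negative"

text \<open>Cutting both diagrams open at their base points and joining them end to end concatenates
  the codes, with the crossing labels made disjoint.\<close>

definition connected_sum :: "'c diagram \<Rightarrow> 'd diagram \<Rightarrow> ('c + 'd) diagram" where
  "connected_sum D E = map (map_passage Inl) D @ map (map_passage Inr) E"

text \<open>Granny knots with either handedness are admitted.\<close>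

definition granny_knots :: "(nat + nat) diagram set" where
  "granny_knots =
     {connected_sum left_trefoil left_trefoil, connected_sum right_trefoil right_trefoil}"

definition square_knot :: "(nat + nat) diagram" where
  "square_knot = connected_sum left_trefoil right_trefoil"


section \<open>Presented groups are groups, and finitely generated ones have finite homomorphism sets\<close>

lemma words_append [simp]: "u @ v \<in> words S \<longleftrightarrow> u \<in> words S \<and> v \<in> words S"
  by (auto simp: words_def)

lemma words_Nil [simp]: "[] \<in> words S"
  by (simp add: words_def)

lemma words_Cons [simp]: "a # u \<in> words S \<longleftrightarrow> fst a \<in> S \<and> u \<in> words S"
  by (cases a) (auto simp: words_def)

lemma word_eq_words: "(u, v) \<in> word_eq S R \<Longrightarrow> u \<in> words S \<and> v \<in> words S"
  by (induction rule: word_eq.induct) auto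

lemma word_eq_context:
  assumes "(u, v) \<in> word_eq S R" "a \<in> words S" "b \<in> words S"
  shows "(a @ u @ b, a @ v @ b) \<in> word_eq S R"
  using assms
proof (induction rule: word_eq.induct)
  case (cancel u v g s)
  then show ?case using word_eq.cancel[of "a @ u" S "v @ b" g s R] by simp
next
  case (relation u v p q)
  then show ?case using word_eq.relation[of "a @ u" S "v @ b" p q R] by simp
next
  case (trans u v w)
  then show ?case by (blast intro: word_eq.trans)
qed (simp_all add: word_eq.refl word_eq.sym)

lemma word_eq_append:
  assumes "(u, u') \<in> word_eq S R" "(v, v') \<in> word_eq S R"
  shows "(u @ v, u' @ v') \<in> word_eq S R"
proof -
  have "(u @ v, u' @ v) \<in> word_eq S R"
    using word_eq_context[OF assms(1), of "[]" v] word_eq_words[OF assms(2)] by simp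
  moreover have "(u' @ v, u' @ v') \<in> word_eq S R"
    using word_eq_context[OF assms(2), of u' "[]"] word_eq_words[OF assms(1)] by simp
  ultimately show ?thesis by (rule word_eq.trans)
qed

lemma equiv_word_eq: "equiv (words S) (word_eq S R)"
proof (rule equivI)
  show "word_eq S R \<subseteq> words S \<times> words S"
    using word_eq_words by fast
  show "refl_on (words S) (word_eq S R)"
    by (auto intro: refl_onI word_eq.refl)
  show "sym (word_eq S R)"
    by (rule symI) (rule word_eq.sym)
  show "trans (word_eq S R)"
    by (rule transI) (rule word_eq.trans)
qed

lemma presented_group_mult:
  assumes "u \<in> words S" "v \<in> words S"
  shows "(word_eq S R `` {u}) \<otimes>\<^bsub>presented_group S R\<^esub> (word_eq S R `` {v}) = word_eq S R `` {u @ v}"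
proof -
  have "word_eq S R `` {u' @ v'} = word_eq S R `` {u @ v}"
    if "u' \<in> word_eq S R `` {u}" "v' \<in> word_eq S R `` {v}" for u' v'
    using that word_eq_append[of u u' S R v v'] equiv_class_eq[OF equiv_word_eq] by fastforce
  moreover have "u \<in> word_eq S R `` {u}" "v \<in> word_eq S R `` {v}"
    using assms by (auto intro: word_eq.refl)
  ultimately have "(\<Union>a\<in>word_eq S R `` {u}. \<Union>b\<in>word_eq S R `` {v}. word_eq S R `` {a @ b})
      = word_eq S R `` {u @ v}"
    by (intro equalityI UN_least) (blast+)
  then show ?thesis
    by (simp add: presented_group_def)
qed

lemma carrier_presented_group:
  "carrier (presented_group S R) = (\<lambda>u. word_eq S R `` {u}) ` words S"
  by (auto simp: presented_group_def quotient_def)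

lemma one_presented_group: "\<one>\<^bsub>presented_group S R\<^esub> = word_eq S R `` {[]}"
  by (simp add: presented_group_def)

lemma word_left_inverse:
  "u \<in> words S \<Longrightarrow> \<exists>v \<in> words S. (v @ u, []) \<in> word_eq S R"
proof (induction u)
  case Nil
  show ?case by (intro bexI[of _ "[]"]) (simp_all add: word_eq.refl)
next
  case (Cons a u)
  obtain g s where a: "a = (g, s)" by (cases a)
  from Cons obtain v where v: "v \<in> words S" "(v @ u, []) \<in> word_eq S R" by auto
  have "opposite (opposite s) = s" by (cases s) auto
  then have "((v @ [(g, opposite s)]) @ a # u, v @ u) \<in> word_eq S R"
    using word_eq.cancel[of v S u g "opposite s" R] v Cons.prems a by simp
  then have "((v @ [(g, opposite s)]) @ a # u, []) \<in> word_eq S R"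
    using v(2) by (rule word_eq.trans)
  moreover have "v @ [(g, opposite s)] \<in> words S" using v Cons.prems a by simp
  ultimately show ?case by blast
qed

lemma group_presented_group: "group (presented_group S R)"
proof (rule groupI)
  fix x assume "x \<in> carrier (presented_group S R)"
  then obtain u where u: "u \<in> words S" "x = word_eq S R `` {u}"
    by (auto simp: carrier_presented_group)
  then obtain v where v: "v \<in> words S" "(v @ u, []) \<in> word_eq S R"
    using word_left_inverse by blast
  have "word_eq S R `` {v} \<otimes>\<^bsub>presented_group S R\<^esub> x = \<one>\<^bsub>presented_group S R\<^esub>"
    using u v equiv_class_eq[OF equiv_word_eq v(2)]
    by (simp add: one_presented_group presented_group_mult)
  then show "\<exists>y\<in>carrier (presented_group S R). y \<otimes>\<^bsub>presented_group S R\<^esub> x = \<one>\<^bsub>presented_group S R\<^esub>"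
    using v(1) by (auto simp: carrier_presented_group)
qed (force simp: carrier_presented_group one_presented_group presented_group_mult)+

lemma Hom_eq_on_generators:
  assumes H: "group H" and h: "h \<in> hom (presented_group S R) H" "k \<in> hom (presented_group S R) H"
    and gen: "\<And>g. g \<in> S \<Longrightarrow> h (word_eq S R `` {[(g, Positive)]}) = k (word_eq S R `` {[(g, Positive)]})"
    and u: "u \<in> words S"
  shows "h (word_eq S R `` {u}) = k (word_eq S R `` {u})"
proof -
  let ?G = "presented_group S R" and ?c = "\<lambda>u. word_eq S R `` {u}"
  interpret G: group ?G by (rule group_presented_group)
  interpret H: group H by (rule H)
  interpret h: group_hom ?G H h by unfold_locales (rule h(1))
  interpret k: group_hom ?G H k by unfold_locales (rule h(2))
  have letter: "h (?c [(g, s)]) = k (?c [(g, s)])" if g: "g \<in> S" for g s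
  proof (cases s)
    case Negative
    have "([(g, Negative), (g, Positive)], []) \<in> word_eq S R"
      using word_eq.cancel[of "[]" S "[]" g Negative R] g by simp
    then have "?c [(g, Negative), (g, Positive)] = ?c []"
      using equiv_class_eq[OF equiv_word_eq] by fast
    then have "?c [(g, Negative)] \<otimes>\<^bsub>?G\<^esub> ?c [(g, Positive)] = \<one>\<^bsub>?G\<^esub>"
      using g by (simp add: presented_group_mult one_presented_group)
    moreover have c: "?c [(g, s)] \<in> carrier ?G" for s
      using g by (auto simp: carrier_presented_group)
    ultimately have "?c [(g, Negative)] = inv\<^bsub>?G\<^esub> (?c [(g, Positive)])"
      by (metis G.inv_equality)
    then show ?thesis using Negative gen[OF g] c by simp
  qed (use gen g in simp)
  show ?thesis using u
  proof (induction u)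
    case Nil
    then show ?case using h.hom_one k.hom_one by (simp add: one_presented_group)
  next
    case (Cons a u)
    obtain g s where a: "a = (g, s)" by (cases a)
    have c: "?c [(g, s)] \<in> carrier ?G" "?c u \<in> carrier ?G"
      using Cons.prems a by (auto simp: carrier_presented_group)
    have "?c (a # u) = ?c [(g, s)] \<otimes>\<^bsub>?G\<^esub> ?c u"
      using Cons.prems a by (simp add: presented_group_mult)
    then show ?case using Cons letter[of g s] a c by simp
  qed
qed

lemma finite_Hom_presented_group:
  assumes "finite S" and H: "group H" and "finite (carrier H)"
  shows "finite (Hom (presented_group S R) H)"
proof -
  let ?G = "presented_group S R"
  let ?f = "\<lambda>h. \<lambda>g\<in>S. h (word_eq S R `` {[(g, Positive)]})"
  have "?f ` Hom ?G H \<subseteq> (\<Pi>\<^sub>E g\<in>S. carrier H)"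
    by (auto simp: Hom_def hom_def carrier_presented_group Pi_iff)
  then have "finite (?f ` Hom ?G H)"
    using assms by (meson finite_PiE finite_subset)
  moreover have "inj_on ?f (Hom ?G H)"
  proof (rule inj_onI)
    fix h k assume hk: "h \<in> Hom ?G H" "k \<in> Hom ?G H" and eq: "?f h = ?f k"
    have "h (word_eq S R `` {u}) = k (word_eq S R `` {u})" if "u \<in> words S" for u
    proof (rule Hom_eq_on_generators[OF H _ _ _ that])
      show "h (word_eq S R `` {[(g, Positive)]}) = k (word_eq S R `` {[(g, Positive)]})"
        if "g \<in> S" for g
        using fun_cong[OF eq, of g] that by simp
    qed (use hk in \<open>auto simp: Hom_def\<close>)
    then show "h = k"
      using hk by (intro extensionalityI[of _ "carrier ?G"]) (auto simp: Hom_def carrier_presented_group)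
  qed
  ultimately show ?thesis by (rule finite_imageD)
qed

lemma group_generalised_knot_group: "group (generalised_knot_group n D)"
  by (simp add: generalised_knot_group_def adjoin_meridian_root_def Let_def group_presented_group)

text \<open>Hence \<^const>\<open>card\<close> is the true cardinality of the homomorphism sets being compared.\<close>

lemma finite_Hom_generalised_knot_group:
  "group H \<Longrightarrow> finite (carrier H) \<Longrightarrow> finite (Hom (generalised_knot_group n D) H)"
  by (simp add: generalised_knot_group_def adjoin_meridian_root_def Let_def finite_Hom_presented_group)

end

theory Submission
  imports Defs "HOL-Algebra.Coset" "HOL-Number_Theory.Cong"
begin

text \<open>A homomorphism from \<open>G\<^sub>n\<close> of a connected sum of two trefoils to \<open>H\<close> is a triple \<open>(\<nu>, c, f)\<close>
  such that, with \<open>a = \<nu>\<^sup>n\<close>, both \<open>c\<close> and \<open>f\<close> satisfy the braid relation with \<open>a\<close>, and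
  \<open>X(c)\<^sup>\<plusminus>\<^sup>1 X(f)\<^sup>\<plusminus>\<^sup>1\<close> commutes with \<open>\<nu>\<close>, where \<open>X(c) = (c a)\<^sup>3\<close>; the signs are those of the two
  trefoils.  Fix \<open>\<nu>\<close>, let \<open>D\<close> be its centralizer and let \<open>m(\<kappa>)\<close>, \<open>m'(\<kappa>)\<close> count the \<open>c\<close> with
  \<open>X(c) \<in> \<kappa>\<close>, respectively \<open>X(c)\<^sup>-\<^sup>1 \<in> \<kappa>\<close>, for right cosets \<open>\<kappa>\<close> of \<open>D\<close>.  The granny knot contributes
  \<open>\<Sum> m m'\<close>, the square knot and its mirror image contribute \<open>\<Sum> m\<^sup>2\<close> and \<open>\<Sum> m'\<^sup>2\<close>.  As the square
  knot is its own mirror image, summing over \<open>\<nu>\<close> shows that it has at least as many homomorphisms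
  to every finite group, and strictly more as soon as \<open>m \<noteq> m'\<close> for a single \<open>\<nu>\<close>.

  A suitable \<open>H\<close> is the group of pairs of a function \<open>(\<int>/p)\<^sup>2 \<rightarrow> \<int>/n\<close> and a matrix in \<open>GL\<^sub>2(p)\<close>,
  with \<open>p > 64\<^sup>n\<close> prime, and \<open>\<nu>\<close> is the pair of the indicator function of \<open>e\<^sub>1 = (1, 0)\<close> and
  \<open>diag(1, 2)\<close>.  Then \<open>\<nu>\<^sup>n = diag(1, \<mu>)\<close> with \<open>\<mu> = 2\<^sup>n\<close>.  Each \<open>X(f)\<close> sends \<open>e\<^sub>1\<close> to \<open>e\<^sub>1\<close> or to
  \<open>- \<mu>\<^sup>3 e\<^sub>1\<close>, and some \<open>X(c)\<close> is the scalar \<open>- \<mu>\<^sup>3\<close>.  Hence \<open>X(c) X(f)\<close> never fixes \<open>e\<^sub>1\<close>, as it would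
  have to in order to commute with \<open>\<nu>\<close>.\<close>

section \<open>Homomorphisms out of a presented group\<close>

primrec signed :: "('a, 'b) monoid_scheme \<Rightarrow> 'a \<Rightarrow> sign \<Rightarrow> 'a" where
  "signed H x Positive = x"
| "signed H x Negative = inv\<^bsub>H\<^esub> x"

primrec eval_word :: "('a, 'b) monoid_scheme \<Rightarrow> ('g \<Rightarrow> 'a) \<Rightarrow> 'g word \<Rightarrow> 'a" where
  "eval_word H \<phi> [] = \<one>\<^bsub>H\<^esub>"
| "eval_word H \<phi> (l # u) = signed H (\<phi> (fst l)) (snd l) \<otimes>\<^bsub>H\<^esub> eval_word H \<phi> u"

text \<open>Extensionality off \<open>S\<close> makes each choice of values on the generators a
  single function, so that cardinalities can be compared with \<open>Hom\<close>.\<close>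

definition satisfying ::
  "'g set \<Rightarrow> ('g word \<times> 'g word) set \<Rightarrow> ('a, 'b) monoid_scheme \<Rightarrow> ('g \<Rightarrow> 'a) set" where
  "satisfying S R H =
     {\<phi> \<in> S \<rightarrow>\<^sub>E carrier H. \<forall>(p, q)\<in>R. eval_word H \<phi> p = eval_word H \<phi> q}"

context group
begin

lemma signed_closed [simp]: "x \<in> carrier G \<Longrightarrow> signed G x s \<in> carrier G"
  by (cases s) auto

lemma eval_word_closed:
  "\<phi> \<in> S \<rightarrow> carrier G \<Longrightarrow> u \<in> words S \<Longrightarrow> eval_word G \<phi> u \<in> carrier G"
  by (induction u) (auto simp: Pi_iff)

lemma eval_word_append:
  "\<phi> \<in> S \<rightarrow> carrier G \<Longrightarrow> u \<in> words S \<Longrightarrow> v \<in> words S \<Longrightarrow>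
    eval_word G \<phi> (u @ v) = eval_word G \<phi> u \<otimes> eval_word G \<phi> v"
  by (induction u) (auto simp: eval_word_closed m_assoc Pi_iff)

text \<open>Evaluation is multiplicative and cancels a letter against its opposite, so it is
  constant on the classes of the congruence generated by relations that it satisfies.\<close>

lemma eval_word_respects:
  assumes "\<phi> \<in> S \<rightarrow> carrier G" "\<And>p q. (p, q) \<in> R \<Longrightarrow> eval_word G \<phi> p = eval_word G \<phi> q"
    and "(u, v) \<in> word_eq S R"
  shows "eval_word G \<phi> u = eval_word G \<phi> v"
  using assms(3)
proof (induction rule: word_eq.induct)
  case (cancel u v g s)
  have "\<phi> g \<in> carrier G" using cancel assms(1) by auto
  then have "eval_word G \<phi> [(g, s), (g, opposite s)] = \<one>" by (cases s) auto
  then show ?case using cancel assms(1) by (simp add: eval_word_append[OF assms(1)] eval_word_closed del: append_Cons eval_word.simps(2))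
next
  case (relation u v p q)
  then show ?case using assms(2)[OF relation(3)] by (simp add: eval_word_append[OF assms(1)])
qed auto

end

text \<open>A negative letter must go to the inverse of the image of its generator, and
  multiplicativity then leaves no freedom beyond the values on the generators.\<close>

lemma hom_eval_word:
  assumes H: "group H" and h: "h \<in> hom (presented_group S R) H" and u: "u \<in> words S"
  shows "h (word_eq S R `` {u}) = eval_word H (\<lambda>g\<in>S. h (word_eq S R `` {[(g, Positive)]})) u"
proof -
  let ?G = "presented_group S R" and ?c = "\<lambda>u. word_eq S R `` {u}"
  let ?\<phi> = "\<lambda>g\<in>S. h (?c [(g, Positive)])"
  interpret G: group ?G by (rule group_presented_group)
  interpret H: group H by (rule H)
  interpret h: group_hom ?G H h by unfold_locales (rule h)
  have letter: "h (?c [(g, s)]) = signed H (?\<phi> g) s" if g: "g \<in> S" for g s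
  proof (cases s)
    case Negative
    have "([(g, Negative), (g, Positive)], []) \<in> word_eq S R"
      using word_eq.cancel[of "[]" S "[]" g Negative R] g by simp
    then have "?c [(g, Negative), (g, Positive)] = ?c []"
      using equiv_class_eq[OF equiv_word_eq] by fast
    then have "?c [(g, Negative)] \<otimes>\<^bsub>?G\<^esub> ?c [(g, Positive)] = \<one>\<^bsub>?G\<^esub>"
      using g by (simp add: presented_group_mult one_presented_group)
    moreover have c: "?c [(g, s)] \<in> carrier ?G" for s
      using g by (auto simp: carrier_presented_group)
    ultimately have "?c [(g, Negative)] = inv\<^bsub>?G\<^esub> (?c [(g, Positive)])"
      by (metis G.inv_equality)
    then show ?thesis using Negative c g by simp
  qed (use g in simp)
  show ?thesis using u
  proof (induction u)
    case Nil
    then show ?case using h.hom_one by (simp add: one_presented_group)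
  next
    case (Cons l u)
    obtain g s where l: "l = (g, s)" by (cases l)
    have c: "?c [(g, s)] \<in> carrier ?G" "?c u \<in> carrier ?G"
      using Cons.prems l by (auto simp: carrier_presented_group)
    have "?c (l # u) = ?c [(g, s)] \<otimes>\<^bsub>?G\<^esub> ?c u"
      using Cons.prems l by (simp add: presented_group_mult)
    then show ?case using Cons letter[of g s] l c by simp
  qed
qed

text \<open>Universal property of a presentation: restriction to the generators is a bijection, with
  evaluation of words as its inverse. A relation with a side outside \<open>words S\<close> would be
  ignored by \<open>word_eq\<close> but not by \<open>satisfying\<close>, which explains the
  hypothesis on \<open>R\<close>.\<close>

lemma card_Hom_presented_group:
  assumes H: "group H" and R: "R \<subseteq> words S \<times> words S"
  shows "card (Hom (presented_group S R) H) = card (satisfying S R H)"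
proof -
  let ?G = "presented_group S R" and ?c = "\<lambda>u. word_eq S R `` {u}"
  let ?f = "\<lambda>h. \<lambda>g\<in>S. h (?c [(g, Positive)])"
  interpret H: group H by (rule H)
  have "bij_betw ?f (Hom ?G H) (satisfying S R H)"
    unfolding bij_betw_def
  proof
    show "inj_on ?f (Hom ?G H)"
    proof (rule inj_onI)
      fix h k assume hk: "h \<in> Hom ?G H" "k \<in> Hom ?G H" and eq: "?f h = ?f k"
      have "h (?c u) = k (?c u)" if "u \<in> words S" for u
        using hom_eval_word[OF H, of h S R u] hom_eval_word[OF H, of k S R u] hk eq that
        by (simp add: Hom_def)
      then show "h = k"
        using hk by (intro extensionalityI[of _ "carrier ?G"]) (auto simp: Hom_def carrier_presented_group)
    qed
    show "?f ` Hom ?G H = satisfying S R H"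
    proof (intro equalityI subsetI)
      fix \<phi> assume "\<phi> \<in> ?f ` Hom ?G H"
      then obtain h where h: "h \<in> hom ?G H" and \<phi>: "\<phi> = ?f h" by (auto simp: Hom_def)
      have "eval_word H \<phi> p = eval_word H \<phi> q" if pq: "(p, q) \<in> R" for p q
      proof -
        have w: "p \<in> words S" "q \<in> words S" using pq R by auto
        have "(p, q) \<in> word_eq S R"
          using word_eq.relation[of "[]" S "[]" p q R] pq w by simp
        then have "?c p = ?c q" using equiv_class_eq[OF equiv_word_eq] by fast
        then show ?thesis using hom_eval_word[OF H h w(1)] hom_eval_word[OF H h w(2)] \<phi> by simp
      qed
      then show "\<phi> \<in> satisfying S R H"
        using h \<phi> by (auto simp: satisfying_def hom_def carrier_presented_group Pi_iff)
    next
      fix \<phi> assume "\<phi> \<in> satisfying S R H"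
      then have \<phi>: "\<phi> \<in> S \<rightarrow>\<^sub>E carrier H" "\<phi> \<in> S \<rightarrow> carrier H"
        "\<And>p q. (p, q) \<in> R \<Longrightarrow> eval_word H \<phi> p = eval_word H \<phi> q"
        by (auto simp: satisfying_def)
      \<comment> \<open>Evaluation at an arbitrary representative; by
        \<open>eval_word_respects\<close> the choice does not matter.\<close>
      define h where "h = (\<lambda>A\<in>carrier ?G. eval_word H \<phi> (SOME u. u \<in> A))"
      have h: "h (?c u) = eval_word H \<phi> u" if u: "u \<in> words S" for u
      proof -
        have "u \<in> ?c u" using u by (auto intro: word_eq.refl)
        then have "(SOME v. v \<in> ?c u) \<in> ?c u" by (rule someI)
        then have "(u, SOME v. v \<in> ?c u) \<in> word_eq S R" by simp
        then show ?thesis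
          using H.eval_word_respects[OF \<phi>(2,3)] u by (simp add: h_def carrier_presented_group)
      qed
      have "h \<in> hom ?G H"
        by (rule homI) (auto simp: carrier_presented_group h presented_group_mult
            H.eval_word_append[OF \<phi>(2)] H.eval_word_closed[OF \<phi>(2)])
      then have "h \<in> Hom ?G H" by (simp add: Hom_def h_def)
      moreover have "?f h = \<phi>"
      proof (rule extensionalityI[of _ S])
        fix g assume g: "g \<in> S"
        then have "\<phi> g \<in> carrier H" using \<phi>(2) by auto
        then show "?f h g = \<phi> g" using g h by simp
      qed (use \<phi>(1) in \<open>auto simp: PiE_def\<close>)
      ultimately show "\<phi> \<in> ?f ` Hom ?G H" by (intro image_eqI[of \<phi> ?f h]) simp_all
    qed
  qed
  then show ?thesis by (rule bij_betw_same_card)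
qed

section \<open>Pairs with matching values\<close>

text \<open>Sort the pairs by their common value, which lies in \<open>K\<close> because it is a
  value of \<open>f\<close>.\<close>

lemma card_matching_pairs:
  assumes "finite T" "finite K" "f ` T \<subseteq> K"
  shows "int (card {(c, d) \<in> T \<times> T. f c = g d}) =
    (\<Sum>k\<in>K. int (card {c \<in> T. f c = k}) * int (card {d \<in> T. g d = k}))"
proof -
  have "{(c, d) \<in> T \<times> T. f c = g d} = (\<Union>k\<in>K. {c \<in> T. f c = k} \<times> {d \<in> T. g d = k})"
    using assms(3) by auto
  also have "card \<dots> = (\<Sum>k\<in>K. card ({c \<in> T. f c = k} \<times> {d \<in> T. g d = k}))"
    by (rule card_UN_disjoint) (use assms in auto)
  finally show ?thesis by (simp add: card_cartesian_product)
qed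

text \<open>The difference of the two sides is the sum of the squares \<open>(m f k - m g k)\<^sup>2\<close>, where \<open>m f k\<close> is
  the size of the fibre of \<open>f\<close> over \<open>k\<close>.\<close>

lemma matching_pairs_le:
  assumes "finite T"
  shows "2 * card {(c, d) \<in> T \<times> T. f c = g d}
    \<le> card {(c, d) \<in> T \<times> T. f c = f d} + card {(c, d) \<in> T \<times> T. g c = g d}" (is ?le)
    and "c0 \<in> T \<Longrightarrow> f c0 \<notin> g ` T \<Longrightarrow> 2 * card {(c, d) \<in> T \<times> T. f c = g d}
    < card {(c, d) \<in> T \<times> T. f c = f d} + card {(c, d) \<in> T \<times> T. g c = g d}" (is "_ \<Longrightarrow> _ \<Longrightarrow> ?less")
proof -
  define K where "K = f ` T \<union> g ` T"
  define m where "m h k = int (card {c \<in> T. h c = k})" for h :: "'a \<Rightarrow> 'b" and k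
  have K: "finite K" "f ` T \<subseteq> K" "g ` T \<subseteq> K" using assms by (auto simp: K_def)
  have "(\<Sum>k\<in>K. (m f k - m g k)\<^sup>2)
      = (\<Sum>k\<in>K. m f k * m f k) + (\<Sum>k\<in>K. m g k * m g k) - 2 * (\<Sum>k\<in>K. m f k * m g k)"
    by (simp add: power2_eq_square algebra_simps sum.distrib sum_subtractf sum_distrib_left)
  also have "\<dots> = int (card {(c, d) \<in> T \<times> T. f c = f d}) + int (card {(c, d) \<in> T \<times> T. g c = g d})
      - 2 * int (card {(c, d) \<in> T \<times> T. f c = g d})"
    using card_matching_pairs[OF assms K(1), of f f] card_matching_pairs[OF assms K(1), of g g]
      card_matching_pairs[OF assms K(1), of f g] K by (simp only: m_def)
  finally have eq: "(\<Sum>k\<in>K. (m f k - m g k)\<^sup>2) = \<dots>" .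
  then show ?le using sum_nonneg[of K "\<lambda>k. (m f k - m g k)\<^sup>2"] by simp
  assume c0: "c0 \<in> T" "f c0 \<notin> g ` T"
  \<comment> \<open>The fibre of \<open>g\<close> over \<open>f c0\<close> is empty and that of
    \<open>f\<close> is not, so one of the squares is positive.\<close>
  have "{d \<in> T. g d = f c0} = {}" using c0(2) by (auto simp: image_iff)
  then have "m g (f c0) = 0" by (simp only: m_def card.empty of_nat_0)
  moreover have "m f (f c0) > 0" using c0 assms by (auto simp: m_def card_gt_0_iff)
  ultimately have "(\<Sum>k\<in>K. (m f k - m g k)\<^sup>2) > 0"
    using c0 K by (intro sum_pos2[of K "f c0"]) auto
  then show ?less using eq by simp
qed

section \<open>Triples describing the homomorphisms\<close>

definition centralizer :: "('a, 'b) monoid_scheme \<Rightarrow> 'a \<Rightarrow> 'a set" where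
  "centralizer G x = {g \<in> carrier G. g \<otimes>\<^bsub>G\<^esub> x = x \<otimes>\<^bsub>G\<^esub> g}"

definition braid_partners :: "('a, 'b) monoid_scheme \<Rightarrow> 'a \<Rightarrow> 'a set" where
  "braid_partners G a = {c \<in> carrier G. a \<otimes>\<^bsub>G\<^esub> c \<otimes>\<^bsub>G\<^esub> a = c \<otimes>\<^bsub>G\<^esub> a \<otimes>\<^bsub>G\<^esub> c}"

text \<open>If \<open>a\<close> and \<open>c\<close> satisfy the braid relation, this is the image
  of the full twist, the generator of the centre of the braid group on three strands.\<close>

definition full_twist :: "('a, 'b) monoid_scheme \<Rightarrow> 'a \<Rightarrow> 'a \<Rightarrow> 'a" where
  "full_twist G a c = (c \<otimes>\<^bsub>G\<^esub> a) [^]\<^bsub>G\<^esub> (3::nat)"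

text \<open>The two signed factors are the longitudes of the trefoil summands up to powers of the
  meridian, and these powers commute with its root \<nu>.\<close>

definition root_triples ::
  "('a, 'b) monoid_scheme \<Rightarrow> nat \<Rightarrow> sign \<Rightarrow> sign \<Rightarrow> ('a \<times> 'a \<times> 'a) set" where
  "root_triples G n s t =
     {(\<nu>, c, f). \<nu> \<in> carrier G \<and>
       c \<in> braid_partners G (\<nu> [^]\<^bsub>G\<^esub> n) \<and> f \<in> braid_partners G (\<nu> [^]\<^bsub>G\<^esub> n) \<and>
       signed G (full_twist G (\<nu> [^]\<^bsub>G\<^esub> n) c) s \<otimes>\<^bsub>G\<^esub> signed G (full_twist G (\<nu> [^]\<^bsub>G\<^esub> n) f) t
         \<in> centralizer G \<nu>}"

context group
begin

lemma subgroup_centralizer: 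
  assumes x: "x \<in> carrier G" shows "subgroup (centralizer G x) G"
proof (rule subgroupI)
  show "centralizer G x \<noteq> {}" using x by (auto simp: centralizer_def intro!: exI[of _ \<one>])
next
  fix g assume "g \<in> centralizer G x"
  then have g: "g \<in> carrier G" "g \<otimes> x = x \<otimes> g" by (auto simp: centralizer_def)
  have "inv g \<otimes> x = x \<otimes> inv g"
    using g x by (metis inv_closed inv_solve_left inv_solve_right m_assoc m_closed)
  then show "inv g \<in> centralizer G x" using g by (simp add: centralizer_def)
next
  fix g h assume "g \<in> centralizer G x" "h \<in> centralizer G x"
  then have *: "g \<in> carrier G" "g \<otimes> x = x \<otimes> g" "h \<in> carrier G" "h \<otimes> x = x \<otimes> h" 
    by (auto simp: centralizer_def)
  then have "g \<otimes> h \<otimes> x = x \<otimes> (g \<otimes> h)" using x by (metis m_assoc)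
  then show "g \<otimes> h \<in> centralizer G x" using * by (simp add: centralizer_def)
qed (auto simp: centralizer_def)

lemma full_twist_closed [simp]:
  "a \<in> carrier G \<Longrightarrow> c \<in> carrier G \<Longrightarrow> full_twist G a c \<in> carrier G"
  by (simp add: full_twist_def)

text \<open>Both \<open>(a c)^3\<close> and \<open>(c a)^3\<close> are products of the equal
  elements \<open>a c a\<close> and \<open>c a c\<close>, so they coincide. This makes up for the
  reversal of factors under inversion.\<close>

lemma inv_full_twist:
  assumes a: "a \<in> carrier G" and c: "c \<in> braid_partners G a"
  shows "inv c \<in> braid_partners G (inv a)" "full_twist G (inv a) (inv c) = inv (full_twist G a c)"
proof -
  have cc: "c \<in> carrier G" and br: "a \<otimes> c \<otimes> a = c \<otimes> a \<otimes> c"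
    using c by (auto simp: braid_partners_def)
  have "inv (a \<otimes> c \<otimes> a) = inv (c \<otimes> a \<otimes> c)" using br by simp
  then show "inv c \<in> braid_partners G (inv a)"
    using a cc by (simp add: braid_partners_def inv_mult_group m_assoc)
  have "a \<otimes> c \<otimes> (a \<otimes> c) \<otimes> (a \<otimes> c) = (a \<otimes> c \<otimes> a) \<otimes> (c \<otimes> a \<otimes> c)" using a cc by (simp add: m_assoc)
  also have "\<dots> = (c \<otimes> a \<otimes> c) \<otimes> (a \<otimes> c \<otimes> a)" by (simp only: br)
  also have "\<dots> = c \<otimes> a \<otimes> (c \<otimes> a) \<otimes> (c \<otimes> a)" using a cc by (simp add: m_assoc)
  finally have "(a \<otimes> c) [^] (3::nat) = (c \<otimes> a) [^] (3::nat)"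
    using a cc by (simp add: numeral_3_eq_3)
  then show "full_twist G (inv a) (inv c) = inv (full_twist G a c)"
    unfolding full_twist_def using a cc by (simp add: inv_mult_group[symmetric] nat_pow_inv)
qed

text \<open>Separates the variables: a condition on a product becomes the equality of two cosets,
  one depending on \<open>c\<close> alone and the other on \<open>f\<close> alone.\<close>

lemma mult_inv_mem_iff_rcos_eq:
  assumes D: "subgroup D G" and g: "g \<in> carrier G" and h: "h \<in> carrier G"
  shows "g \<otimes> inv h \<in> D \<longleftrightarrow> D #> g = D #> h"
proof
  assume "g \<otimes> inv h \<in> D"
  then have "(g \<otimes> inv h) \<otimes> h \<in> D #> h" by (auto simp: r_coset_def)
  then have "g \<in> D #> h" using g h by (simp add: m_assoc)
  then show "D #> g = D #> h" using repr_independence[OF _ h D] by blast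
next
  assume "D #> g = D #> h"
  then have "g \<in> D #> h" using rcos_self[OF g D] by simp
  then obtain d where d: "d \<in> D" "g = d \<otimes> h" by (auto simp: r_coset_def)
  then have "g \<otimes> inv h = d" using D h by (metis inv_solve_right' subgroup.mem_carrier g)
  then show "g \<otimes> inv h \<in> D" using d by simp
qed

end

section \<open>Comparison of the counts over each root \<nu>\<close>

definition pairs_over ::
  "('a, 'b) monoid_scheme \<Rightarrow> nat \<Rightarrow> sign \<Rightarrow> sign \<Rightarrow> 'a \<Rightarrow> ('a \<times> 'a) set" where
  "pairs_over G n s t \<nu> = {(c, f). (\<nu>, c, f) \<in> root_triples G n s t}"

locale finite_group = group G for G (structure) +
  assumes finite_carrier [simp, intro]: "finite (carrier G)"
begin

lemma card_root_triples:
  "card (root_triples G n s t) = (\<Sum>\<nu>\<in>carrier G. card (pairs_over G n s t \<nu>))"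
proof -
  have "root_triples G n s t = (\<Union>\<nu>\<in>carrier G. {\<nu>} \<times> pairs_over G n s t \<nu>)"
    by (auto simp: pairs_over_def root_triples_def)
  also have "card \<dots> = (\<Sum>\<nu>\<in>carrier G. card ({\<nu>} \<times> pairs_over G n s t \<nu>))"
  proof (rule card_UN_disjoint)
    have "finite (pairs_over G n s t \<nu>)" for \<nu>
      by (rule finite_subset[of _ "carrier G \<times> carrier G"])
        (auto simp: pairs_over_def root_triples_def braid_partners_def)
    then show "\<forall>i\<in>carrier G. finite ({i} \<times> pairs_over G n s t i)" by blast
  qed auto
  finally show ?thesis by (simp add: card_cartesian_product)
qed

text \<open>Inverting all three entries amounts to reflecting the knot, and the square knot is its own
  mirror image.\<close>

lemma card_root_triples_inverse:
  "card (root_triples G n Negative Positive) = card (root_triples G n Positive Negative)"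
proof (rule bij_betw_same_card)
  let ?i = "\<lambda>(\<nu>, c, f). (inv \<nu>, inv c, inv f)"
  have mem: "?i x \<in> root_triples G n (opposite s) (opposite t)" if "x \<in> root_triples G n s t" for x s t
  proof -
    obtain \<nu> c f where x: "x = (\<nu>, c, f)" by (cases x)
    let ?a = "\<nu> [^] n"
    have *: "\<nu> \<in> carrier G" "c \<in> braid_partners G ?a" "f \<in> braid_partners G ?a"
      "signed G (full_twist G ?a c) s \<otimes> signed G (full_twist G ?a f) t \<in> centralizer G \<nu>"
      using that x by (auto simp: root_triples_def)
    have cf: "c \<in> carrier G" "f \<in> carrier G" using *(2,3) by (auto simp: braid_partners_def)
    have sg: "signed G (inv y) (opposite r) = signed G y r" if "y \<in> carrier G" for y r
      using that by (cases r) auto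
    have ce: "centralizer G (inv \<nu>) = centralizer G \<nu>"
    proof -
      have "g \<otimes> inv \<nu> = inv \<nu> \<otimes> g \<longleftrightarrow> g \<otimes> \<nu> = \<nu> \<otimes> g" if "g \<in> carrier G" for g
        using *(1) that by (metis inv_closed inv_solve_left inv_solve_right m_assoc m_closed)
      then show ?thesis by (auto simp: centralizer_def)
    qed
    show ?thesis
      using * cf inv_full_twist[of ?a c] inv_full_twist[of ?a f]
      by (simp add: x root_triples_def nat_pow_inv[symmetric] sg ce)
  qed
  show "bij_betw ?i (root_triples G n Negative Positive) (root_triples G n Positive Negative)"
  proof (rule bij_betw_byWitness[where f' = ?i])
    show "?i ` root_triples G n Negative Positive \<subseteq> root_triples G n Positive Negative"
      using mem[of _ Negative Positive] by auto
    show "?i ` root_triples G n Positive Negative \<subseteq> root_triples G n Negative Positive"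
      using mem[of _ Positive Negative] by auto
  qed (auto simp: root_triples_def braid_partners_def)
qed

text \<open>The inverse of \<open>X(c)^-1 X(f)^-1\<close> is \<open>X(f) X(c)\<close>, and
  centralizers are closed under inverses. Hence exchanging the two summands, with \<nu> kept,
  matches the two conditions.\<close>

lemma card_root_triples_Negative:
  "card (root_triples G n Negative Negative) = card (root_triples G n Positive Positive)"
proof (rule bij_betw_same_card)
  let ?i = "\<lambda>(\<nu>, c, f). (\<nu>, f, c)"
  have *: "inv x \<otimes> inv y \<in> centralizer G \<nu> \<longleftrightarrow> y \<otimes> x \<in> centralizer G \<nu>"
    if "x \<in> carrier G" "y \<in> carrier G" "\<nu> \<in> carrier G" for x y \<nu>
    using that subgroup.m_inv_closed[OF subgroup_centralizer[of \<nu>]]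
    by (metis inv_mult_group inv_inv m_closed inv_closed)
  show "bij_betw ?i (root_triples G n Negative Negative) (root_triples G n Positive Positive)"
    by (rule bij_betw_byWitness[where f' = ?i]) (auto simp: root_triples_def braid_partners_def *)
qed

lemma card_root_triples_less:
  assumes \<nu>: "\<nu> \<in> carrier G" and c: "c \<in> braid_partners G (\<nu> [^] n)"
    and no: "\<And>f. f \<in> braid_partners G (\<nu> [^] n) \<Longrightarrow>
      full_twist G (\<nu> [^] n) c \<otimes> full_twist G (\<nu> [^] n) f \<notin> centralizer G \<nu>"
  shows "card (root_triples G n Positive Positive) < card (root_triples G n Negative Positive)"
proof -
  define F where "F x y = centralizer G x #> full_twist G (x [^] n) y" for x y
  define F' where "F' x y = centralizer G x #> inv (full_twist G (x [^] n) y)" for x y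
  define T where "T x = braid_partners G (x [^] n)" for x
  have T: "T x \<subseteq> carrier G" for x by (auto simp: T_def braid_partners_def)
  then have finT: "finite (T x)" for x by (rule finite_subset) simp
  have coset: "g \<otimes> inv h \<in> centralizer G x \<longleftrightarrow> centralizer G x #> g = centralizer G x #> h"
    if "x \<in> carrier G" "g \<in> carrier G" "h \<in> carrier G" for x g h
    using mult_inv_mem_iff_rcos_eq[OF subgroup_centralizer] that by blast
  have coset': "g \<otimes> h \<in> centralizer G x \<longleftrightarrow> centralizer G x #> g = centralizer G x #> inv h"
    if "x \<in> carrier G" "g \<in> carrier G" "h \<in> carrier G" for x g h
    using coset[of x g "inv h"] that by simp
  \<comment> \<open>A factor with positive sign in front contributes \<open>F\<close>, one with
    negative sign \<open>F'\<close>; behind it is the other way round, since cosets are compared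
    through the inverse of the second factor.\<close>
  have PP: "pairs_over G n Positive Positive x = {(c, d) \<in> T x \<times> T x. F x c = F' x d}"
   and PN: "pairs_over G n Positive Negative x = {(c, d) \<in> T x \<times> T x. F x c = F x d}"
   and NP: "pairs_over G n Negative Positive x = {(c, d) \<in> T x \<times> T x. F' x c = F' x d}"
    if x: "x \<in> carrier G" for x
  proof -
    have "full_twist G (x [^] n) d \<in> carrier G" if "d \<in> T x" for d
      using subsetD[OF T that] x by simp
    then show "pairs_over G n Positive Positive x = {(c, d) \<in> T x \<times> T x. F x c = F' x d}"
      "pairs_over G n Positive Negative x = {(c, d) \<in> T x \<times> T x. F x c = F x d}"
      "pairs_over G n Negative Positive x = {(c, d) \<in> T x \<times> T x. F' x c = F' x d}"
      using x unfolding F_def F'_def pairs_over_def root_triples_def T_def[symmetric]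
      by (auto simp: coset coset')
  qed
  have "2 * card (root_triples G n Positive Positive)
      = (\<Sum>x\<in>carrier G. 2 * card {(c, d) \<in> T x \<times> T x. F x c = F' x d})"
    by (simp add: card_root_triples PP sum_distrib_left)
  also have "\<dots> < (\<Sum>x\<in>carrier G. card {(c, d) \<in> T x \<times> T x. F x c = F x d}
      + card {(c, d) \<in> T x \<times> T x. F' x c = F' x d})"
  proof (rule sum_strict_mono_ex1)
    \<comment> \<open>Equality of the two cosets would put the product of the full twists into the
      centralizer, contrary to \<open>no\<close>.\<close>
    have "F \<nu> c \<notin> F' \<nu> ` T \<nu>"
    proof
      assume "F \<nu> c \<in> F' \<nu> ` T \<nu>"
      then obtain f where "f \<in> T \<nu>" "F \<nu> c = F' \<nu> f" by auto
      then have "(c, f) \<in> pairs_over G n Positive Positive \<nu>" using c PP[OF \<nu>] by (simp add: T_def)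
      then show False using no[of f] by (simp add: pairs_over_def root_triples_def)
    qed
    then show "\<exists>x\<in>carrier G. 2 * card {(c, d) \<in> T x \<times> T x. F x c = F' x d}
      < card {(c, d) \<in> T x \<times> T x. F x c = F x d} + card {(c, d) \<in> T x \<times> T x. F' x c = F' x d}"
      using matching_pairs_le(2)[OF finT[of \<nu>], of c "F \<nu>" "F' \<nu>"] c \<nu> by (auto simp: T_def)
  qed (use matching_pairs_le(1)[OF finT] in auto)
  \<comment> \<open>Summed over all roots, the two square knot counts agree by reflection, so the
    factor 2 cancels.\<close>
  also have "\<dots> = card (root_triples G n Positive Negative) + card (root_triples G n Negative Positive)"
    by (simp add: card_root_triples PN NP sum.distrib)
  finally show ?thesis by (simp add: card_root_triples_inverse)
qed

end

section \<open>The presentations of the two knots\<close>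

context group
begin

lemma inv_mult_eq_mult_inv_iff:
  assumes "x \<in> carrier G" "y \<in> carrier G" "z \<in> carrier G"
  shows "inv x \<otimes> y = z \<otimes> inv x \<longleftrightarrow> y \<otimes> x = x \<otimes> z"
  using assms by (metis inv_closed inv_solve_left inv_solve_right m_assoc m_closed)

text \<open>Positive crossings, with the trefoil cut open into four arcs. The relations give
  \<open>g1 g3 = g2 g1 = g0 g2 = g1 g0\<close>, so cancelling \<open>g1\<close> shows that the last
  arc carries the same element as the first.\<close>

lemma braid_iff_wirtinger:
  assumes "g0 \<in> carrier G" "g1 \<in> carrier G" "g2 \<in> carrier G" "g3 \<in> carrier G"
  shows "(g2 \<otimes> g1 = g0 \<otimes> g2 \<and> g0 \<otimes> g2 = g1 \<otimes> g0 \<and> g1 \<otimes> g3 = g2 \<otimes> g1) \<longleftrightarrow>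
    (g3 = g0 \<and> g0 \<otimes> g2 \<otimes> g0 = g2 \<otimes> g0 \<otimes> g2 \<and> g2 \<otimes> g1 = g0 \<otimes> g2)"
proof safe
  assume *: "g2 \<otimes> g1 = g0 \<otimes> g2" "g0 \<otimes> g2 = g1 \<otimes> g0" "g1 \<otimes> g3 = g2 \<otimes> g1"
  then have "g1 \<otimes> g3 = g1 \<otimes> g0" by simp
  then show "g3 = g0" using assms by simp
  show "g0 \<otimes> g2 \<otimes> g0 = g2 \<otimes> g0 \<otimes> g2" using * assms by (metis m_assoc)
next
  assume *: "g0 \<otimes> g2 \<otimes> g0 = g2 \<otimes> g0 \<otimes> g2" "g2 \<otimes> g1 = g0 \<otimes> g2"
  have "g2 \<otimes> (g1 \<otimes> g0) = g2 \<otimes> (g0 \<otimes> g2)" using * assms by (metis m_assoc)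
  then show "g0 \<otimes> g2 = g1 \<otimes> g0" using assms by simp
  then show "g1 \<otimes> g0 = g2 \<otimes> g1" using * by simp
qed

text \<open>Negative crossings, with the inverses cleared; here
  \<open>g3 g1 = g1 g2 = g2 g0 = g0 g1\<close>, and \<open>g1\<close> cancels on the right.\<close>

lemma braid_iff_wirtinger':
  assumes "g0 \<in> carrier G" "g1 \<in> carrier G" "g2 \<in> carrier G" "g3 \<in> carrier G"
  shows "(g1 \<otimes> g2 = g2 \<otimes> g0 \<and> g2 \<otimes> g0 = g0 \<otimes> g1 \<and> g3 \<otimes> g1 = g1 \<otimes> g2) \<longleftrightarrow>
    (g3 = g0 \<and> g0 \<otimes> g2 \<otimes> g0 = g2 \<otimes> g0 \<otimes> g2 \<and> g1 \<otimes> g2 = g2 \<otimes> g0)"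
proof safe
  assume *: "g1 \<otimes> g2 = g2 \<otimes> g0" "g2 \<otimes> g0 = g0 \<otimes> g1" "g3 \<otimes> g1 = g1 \<otimes> g2"
  then have "g3 \<otimes> g1 = g0 \<otimes> g1" by simp
  then show "g3 = g0" using assms by simp
  show "g0 \<otimes> g2 \<otimes> g0 = g2 \<otimes> g0 \<otimes> g2" using * assms by (metis m_assoc)
next
  assume *: "g0 \<otimes> g2 \<otimes> g0 = g2 \<otimes> g0 \<otimes> g2" "g1 \<otimes> g2 = g2 \<otimes> g0"
  have "(g0 \<otimes> g1) \<otimes> g2 = (g2 \<otimes> g0) \<otimes> g2" using * assms by (metis m_assoc)
  then show "g2 \<otimes> g0 = g0 \<otimes> g1" using assms by (metis m_closed right_cancel)
  then show "g0 \<otimes> g1 = g1 \<otimes> g2" using * by simp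
qed

text \<open>Eliminates the arcs \<open>g1\<close> and \<open>g3\<close> for both handednesses at
  once, so that a summand is described by the meridian \<open>g0\<close> and one braid partner
  \<open>g2\<close>.\<close>

lemma trefoil_relations_iff:
  assumes g: "g0 \<in> carrier G" "g1 \<in> carrier G" "g2 \<in> carrier G" "g3 \<in> carrier G"
  shows "(signed G g2 s \<otimes> g1 = g0 \<otimes> signed G g2 s \<and> signed G g0 s \<otimes> g2 = g1 \<otimes> signed G g0 s \<and>
      signed G g1 s \<otimes> g3 = g2 \<otimes> signed G g1 s) \<longleftrightarrow>
    (g3 = g0 \<and> g2 \<in> braid_partners G g0 \<and> g1 = inv (signed G g2 s) \<otimes> (g0 \<otimes> signed G g2 s))"
proof -
  have eq: "g1 = inv x \<otimes> (g0 \<otimes> x) \<longleftrightarrow> x \<otimes> g1 = g0 \<otimes> x" if "x \<in> carrier G" for x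
    using that g by (metis inv_solve_left m_closed)
  show ?thesis
  proof (cases s)
    case Positive
    then show ?thesis using braid_iff_wirtinger[OF g] g eq by (auto simp: braid_partners_def)
  next
    case Negative
    then show ?thesis using braid_iff_wirtinger'[OF g] g eq[of "inv g2"]
      by (auto simp: braid_partners_def inv_mult_eq_mult_inv_iff)
  qed
qed

text \<open>The braid relation collects a factor \<open>a a\<close> at either end: on the right for
  the longitude of the positive trefoil, on the left for that of the negative one.\<close>

lemma full_twist_expand:
  assumes a: "a \<in> carrier G" and c: "c \<in> braid_partners G a"
  shows "full_twist G a c = c \<otimes> a \<otimes> (a \<otimes> c) \<otimes> (a \<otimes> a)" 
    and "full_twist G a c = a \<otimes> a \<otimes> (c \<otimes> a) \<otimes> (a \<otimes> c)"
proof -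
  have cc: "c \<in> carrier G" and br: "a \<otimes> c \<otimes> a = c \<otimes> a \<otimes> c"
    using c by (auto simp: braid_partners_def)
  have "full_twist G a c = c \<otimes> a \<otimes> (c \<otimes> a \<otimes> c) \<otimes> a"
    using a cc by (simp add: full_twist_def numeral_3_eq_3 m_assoc)
  also have "\<dots> = c \<otimes> a \<otimes> (a \<otimes> c) \<otimes> (a \<otimes> a)"
    unfolding br[symmetric] using a cc by (simp add: m_assoc)
  finally show 1: "full_twist G a c = c \<otimes> a \<otimes> (a \<otimes> c) \<otimes> (a \<otimes> a)" .
  have "full_twist G a c = (c \<otimes> a \<otimes> c) \<otimes> (a \<otimes> c \<otimes> a)"
    using a cc by (simp add: full_twist_def numeral_3_eq_3 m_assoc)
  also have "\<dots> = (a \<otimes> c \<otimes> a) \<otimes> (c \<otimes> a \<otimes> c)" by (simp only: br)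
  also have "\<dots> = a \<otimes> (c \<otimes> a \<otimes> c) \<otimes> (a \<otimes> c)"
    using a cc by (simp add: m_assoc)
  also have "\<dots> = a \<otimes> a \<otimes> (c \<otimes> a) \<otimes> (a \<otimes> c)"
    unfolding br[symmetric] using a cc by (simp add: m_assoc)
  finally show "full_twist G a c = a \<otimes> a \<otimes> (c \<otimes> a) \<otimes> (a \<otimes> c)" .
qed

text \<open>In \<open>a c a c a c a\<close>, read as \<open>(a c a)(c a c) a\<close>, the first two
  factors are equal and may be exchanged; the result is the full twist followed by
  \<open>a\<close>.\<close>

lemma full_twist_commute:
  assumes a: "a \<in> carrier G" and c: "c \<in> braid_partners G a"
  shows "a \<otimes> full_twist G a c = full_twist G a c \<otimes> a"
proof -
  have cc: "c \<in> carrier G" and br: "a \<otimes> c \<otimes> a = c \<otimes> a \<otimes> c"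
    using c by (auto simp: braid_partners_def)
  have "a \<otimes> full_twist G a c = (a \<otimes> c \<otimes> a) \<otimes> (c \<otimes> a \<otimes> c) \<otimes> a"
    using a cc by (simp add: full_twist_def numeral_3_eq_3 m_assoc)
  also have "\<dots> = (c \<otimes> a \<otimes> c) \<otimes> (a \<otimes> c \<otimes> a) \<otimes> a" by (simp only: br)
  also have "\<dots> = full_twist G a c \<otimes> a"
    using a cc by (simp add: full_twist_def numeral_3_eq_3 m_assoc)
  finally show ?thesis .
qed

text \<open>The left side is the product of the letters met at the three underpasses. It differs
  from the signed full twist only by a power of the meridian, which the condition of commuting with
  \<nu> does not see.\<close>

lemma trefoil_longitude:
  assumes a: "a \<in> carrier G" and c: "c \<in> braid_partners G a"
  shows "signed G c s \<otimes> (signed G a s \<otimes> signed G (inv (signed G c s) \<otimes> (a \<otimes> signed G c s)) s)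
    = signed G (full_twist G a c) s \<otimes> signed G (a \<otimes> (a \<otimes> a)) (opposite s)"
proof -
  have cc: "c \<in> carrier G" and br: "a \<otimes> c \<otimes> a = c \<otimes> a \<otimes> c"
    using c by (auto simp: braid_partners_def)
  show ?thesis
  proof (cases s)
    case Positive
    have "c \<otimes> (inv c \<otimes> (a \<otimes> c) \<otimes> a) = c \<otimes> (a \<otimes> c)"
      using a cc br by (simp add: m_assoc[symmetric])
    then have "inv c \<otimes> (a \<otimes> c) \<otimes> a = a \<otimes> c" using a cc by simp
    moreover have "c \<otimes> (a \<otimes> (inv c \<otimes> (a \<otimes> c))) \<otimes> (a \<otimes> (a \<otimes> a))
        = c \<otimes> (a \<otimes> (inv c \<otimes> (a \<otimes> c) \<otimes> a \<otimes> (a \<otimes> a)))"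
      using a cc by (simp add: m_assoc)
    ultimately have "c \<otimes> (a \<otimes> (inv c \<otimes> (a \<otimes> c))) \<otimes> (a \<otimes> (a \<otimes> a)) = full_twist G a c"
      using a cc by (simp add: full_twist_expand(1)[OF a c] m_assoc)
    then show ?thesis using Positive a cc
      by (simp add: inv_solve_right[symmetric])
  next
    case Negative
    let ?g = "c \<otimes> (a \<otimes> inv c)"
    \<comment> \<open>The braid relation moves \<open>a\<close> past the eliminated arc
      \<open>?g\<close>, the conjugate of \<open>a\<close> by \<open>c\<close>.\<close>
    have "(a \<otimes> ?g) \<otimes> c = (c \<otimes> a) \<otimes> c" using a cc br by (simp add: m_assoc)
    then have ag: "a \<otimes> ?g = c \<otimes> a" using a cc by (metis inv_closed m_closed right_cancel)
    have "(a \<otimes> (a \<otimes> a)) \<otimes> (?g \<otimes> (a \<otimes> c)) = a \<otimes> a \<otimes> (a \<otimes> ?g) \<otimes> (a \<otimes> c)"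
      using a cc by (simp add: m_assoc)
    also have "\<dots> = full_twist G a c" by (simp add: ag full_twist_expand(2)[OF a c])
    finally have "?g \<otimes> (a \<otimes> c) = inv (a \<otimes> (a \<otimes> a)) \<otimes> full_twist G a c"
      using a cc by (metis full_twist_closed inv_closed inv_solve_left m_closed)
    then have "inv (?g \<otimes> (a \<otimes> c)) = inv (full_twist G a c) \<otimes> (a \<otimes> (a \<otimes> a))"
      using a cc by (simp add: inv_mult_group[of "inv (a \<otimes> (a \<otimes> a))"] del: inv_mult_group)
    moreover have "inv (?g \<otimes> (a \<otimes> c)) = inv c \<otimes> (inv a \<otimes> inv ?g)"
      using a cc by (simp add: inv_mult_group m_assoc)
    ultimately show ?thesis using Negative a cc by simp
  qed
qed

lemma eval_word_replicate:
  "\<phi> g \<in> carrier G \<Longrightarrow> eval_word G \<phi> (replicate k (g, Positive)) = \<phi> g [^] k"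
  by (induction k) (simp, simp only: replicate_Suc eval_word.simps fst_conv snd_conv signed.simps nat_pow_Suc2)

lemma eval_power_word_in_subgroup:
  assumes "subgroup K G" "\<phi> g \<in> K"
  shows "eval_word G \<phi> (power_word g k) \<in> K"
proof -
  have "eval_word G \<phi> (replicate i (g, s)) \<in> K" for i s
    using assms by (induction i; cases s) (auto simp: subgroup.one_closed subgroup.m_closed subgroup.m_inv_closed)
  then show ?thesis by (simp add: power_word_def)
qed

end

section \<open>Arcs, relations and longitude of the connected sum\<close>

lemma underpasses_connected_sum_trefoils:
  "underpasses (connected_sum (trefoil s) (trefoil t)) =
    [Under (Inl 2) s, Under (Inl 1) s, Under (Inl 3) s, Under (Inr 2) t, Under (Inr 1) t, Under (Inr 3) t]"
  by (simp add: underpasses_def connected_sum_def trefoil_def)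

text \<open>The code of each summand opens with its overpass of crossing 1, which therefore lies on
  arc 0 or arc 3, the two arcs joining the summands.\<close>

lemma over_arc_connected_sum_trefoils:
  fixes s t defines "D \<equiv> connected_sum (trefoil s) (trefoil t)"
  shows "over_arc D (Inl 1) = 0" "over_arc D (Inl 2) = 2" "over_arc D (Inl 3) = 1"
    "over_arc D (Inr 1) = 3" "over_arc D (Inr 2) = 5" "over_arc D (Inr 3) = 4"
  by (simp_all add: D_def over_arc_def arc_count_def underpasses_def connected_sum_def trefoil_def)

lemma arc_count_connected_sum_trefoils: "arc_count (connected_sum (trefoil s) (trefoil t)) = 6"
  by (simp add: arc_count_def underpasses_connected_sum_trefoils)

lemma wirtinger_relations_connected_sum_trefoils:
  "wirtinger_relations (connected_sum (trefoil s) (trefoil t)) =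
    {([(2, s), (1, Positive)], [(0, Positive), (2, s)]),
     ([(0, s), (2, Positive)], [(1, Positive), (0, s)]),
     ([(1, s), (3, Positive)], [(2, Positive), (1, s)]),
     ([(5, t), (4, Positive)], [(3, Positive), (5, t)]),
     ([(3, t), (5, Positive)], [(4, Positive), (3, t)]),
     ([(4, t), (0, Positive)], [(5, Positive), (4, t)])}"
proof -
  let ?D = "connected_sum (trefoil s) (trefoil t)"
  let ?f = "\<lambda>j. ([over_letter ?D (underpasses ?D ! j), (Suc j mod 6, Positive)],
       [(j, Positive), over_letter ?D (underpasses ?D ! j)])"
  have "wirtinger_relations ?D = ?f ` {0, 1, 2, 3, 4, 5}"
  proof -
    have "{..<6} = {0, 1, 2, 3, 4, 5::nat}" by auto
    moreover have "wirtinger_relations ?D = ?f ` {..<6}"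
      unfolding wirtinger_relations_def arc_count_connected_sum_trefoils
      by (auto simp: underpasses_connected_sum_trefoils)
    ultimately show ?thesis by simp
  qed
  then show ?thesis
    by (simp add: over_letter_def underpasses_connected_sum_trefoils
        over_arc_connected_sum_trefoils[unfolded One_nat_def] over_arc_connected_sum_trefoils
        numeral_2_eq_2[symmetric])
qed

lemma longitude_connected_sum_trefoils:
  "longitude (connected_sum (trefoil s) (trefoil t)) =
    [(2, s), (0, s), (1, s), (5, t), (3, t), (4, t)]
    @ power_word 0 (- writhe (connected_sum (trefoil s) (trefoil t)))"
  by (simp add: longitude_def over_letter_def underpasses_connected_sum_trefoils
        over_arc_connected_sum_trefoils[unfolded One_nat_def] over_arc_connected_sum_trefoils)

text \<open>Only the values at \<nu> and at the arcs 2 and 5 are free: the arcs 0 and 3 carry the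
  meridian \<open>\<nu>^n\<close>, and the arcs 1 and 4 carry conjugates of it.\<close>

lemma card_Hom_connected_sum_trefoils:
  fixes H :: "('a, 'b) monoid_scheme"
  assumes "group H"
  shows "card (Hom (generalised_knot_group n (connected_sum (trefoil s) (trefoil t))) H)
    = card (root_triples H n s t)"
proof -
  interpret group H by (rule assms)
  define S where "S = insert None (Some ` {..<6::nat})"
  define emb :: "nat word \<Rightarrow> nat option word" where "emb = map (map_prod Some id)"
  define D where "D = connected_sum (trefoil s) (trefoil t)"
  define \<nu> where "\<nu> = (None :: nat option, Positive)"
  define R where "R = map_prod emb emb ` wirtinger_relations D \<union>
    {(replicate n \<nu>, emb (meridian D)), (emb (longitude D) @ [\<nu>], [\<nu>] @ emb (longitude D))}"
  have S: "None \<in> S" "Some 0 \<in> S" "Some (Suc 0) \<in> S" "Some 2 \<in> S" "Some 3 \<in> S" "Some 4 \<in> S" "Some 5 \<in> S"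
    by (auto simp: S_def)
  have S_cases: "x = None \<or> x = Some 0 \<or> x = Some (Suc 0) \<or> x = Some 2 \<or> x = Some 3 \<or> x = Some 4 \<or> x = Some 5"
    if "x \<in> S" for x using that by (auto simp: S_def)
  have K: "generalised_knot_group n D = presented_group S R"
    by (simp add: generalised_knot_group_def adjoin_meridian_root_def Let_def emb_def \<nu>_def
        S_def R_def D_def arc_count_connected_sum_trefoils)
  have power_words: "emb (power_word 0 k) = power_word (Some 0) k" for k
    by (simp add: emb_def power_word_def)
  have words: "replicate k l \<in> words S \<longleftrightarrow> k = 0 \<or> fst l \<in> S" for k and l :: "nat option \<times> sign"
    by (induction k) auto
  have pw: "power_word (Some 0) k \<in> words S" for k
    using S by (simp add: power_word_def words)
  have longitude: "emb (longitude D) = [(Some 2, s), (Some 0, s), (Some 1, s), (Some 5, t), (Some 3, t), (Some 4, t)]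
      @ power_word (Some 0) (- writhe D)"
    by (simp add: D_def longitude_connected_sum_trefoils power_words[symmetric] emb_def)
  have R_words: "R \<subseteq> words S \<times> words S"
    using S pw by (auto simp: R_def D_def[symmetric] longitude words \<nu>_def meridian_def)
      (auto simp: D_def wirtinger_relations_connected_sum_trefoils emb_def)
  have sat: "\<phi> \<in> satisfying S R H \<longleftrightarrow>
      \<phi> (Some 0) = \<phi> None [^]\<^bsub>H\<^esub> n \<and> \<phi> (Some 3) = \<phi> None [^]\<^bsub>H\<^esub> n \<and>
      \<phi> (Some 1) = inv\<^bsub>H\<^esub> (signed H (\<phi> (Some 2)) s) \<otimes>\<^bsub>H\<^esub> (\<phi> (Some 0) \<otimes>\<^bsub>H\<^esub> signed H (\<phi> (Some 2)) s) \<and>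
      \<phi> (Some 4) = inv\<^bsub>H\<^esub> (signed H (\<phi> (Some 5)) t) \<otimes>\<^bsub>H\<^esub> (\<phi> (Some 0) \<otimes>\<^bsub>H\<^esub> signed H (\<phi> (Some 5)) t) \<and>
      (\<phi> None, \<phi> (Some 2), \<phi> (Some 5)) \<in> root_triples H n s t"
    if \<phi>: "\<phi> \<in> S \<rightarrow>\<^sub>E carrier H" for \<phi>
  proof -
    define \<nu>' g0 g1 g2 g3 g4 g5 where g_def: "\<nu>' = \<phi> None" "g0 = \<phi> (Some 0)" "g1 = \<phi> (Some 1)"
      "g2 = \<phi> (Some 2)" "g3 = \<phi> (Some 3)" "g4 = \<phi> (Some 4)" "g5 = \<phi> (Some 5)"
    have g: "\<nu>' \<in> carrier H" "g0 \<in> carrier H" "g1 \<in> carrier H" "g2 \<in> carrier H" "g3 \<in> carrier H"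
      "g4 \<in> carrier H" "g5 \<in> carrier H"
      using \<phi> S by (auto simp: g_def)
    have \<phi>': "\<phi> \<in> S \<rightarrow> carrier H" using \<phi> by auto
    define p where "p = eval_word H \<phi> (power_word (Some 0) (- writhe D))"
    have p: "p \<in> carrier H" unfolding p_def by (rule eval_word_closed[OF \<phi>' pw])
    let ?l = "signed H g2 s \<otimes>\<^bsub>H\<^esub> (signed H g0 s \<otimes>\<^bsub>H\<^esub> (signed H g1 s \<otimes>\<^bsub>H\<^esub>
      (signed H g5 t \<otimes>\<^bsub>H\<^esub> (signed H g3 t \<otimes>\<^bsub>H\<^esub> (signed H g4 t \<otimes>\<^bsub>H\<^esub> p)))))"
    have l: "eval_word H \<phi> (emb (longitude D)) = ?l"
      by (simp add: longitude g_def p_def)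
    have lw: "emb (longitude D) \<in> words S" using S pw by (simp add: longitude)
    have "\<phi> \<in> satisfying S R H \<longleftrightarrow>
      (signed H g2 s \<otimes>\<^bsub>H\<^esub> g1 = g0 \<otimes>\<^bsub>H\<^esub> signed H g2 s \<and>
       signed H g0 s \<otimes>\<^bsub>H\<^esub> g2 = g1 \<otimes>\<^bsub>H\<^esub> signed H g0 s \<and>
       signed H g1 s \<otimes>\<^bsub>H\<^esub> g3 = g2 \<otimes>\<^bsub>H\<^esub> signed H g1 s) \<and>
      (signed H g5 t \<otimes>\<^bsub>H\<^esub> g4 = g3 \<otimes>\<^bsub>H\<^esub> signed H g5 t \<and>
       signed H g3 t \<otimes>\<^bsub>H\<^esub> g5 = g4 \<otimes>\<^bsub>H\<^esub> signed H g3 t \<and>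
       signed H g4 t \<otimes>\<^bsub>H\<^esub> g0 = g5 \<otimes>\<^bsub>H\<^esub> signed H g4 t) \<and>
      g0 = \<nu>' [^]\<^bsub>H\<^esub> n \<and> ?l \<in> centralizer H \<nu>'"
    proof -
      have "eval_word H \<phi> (emb (longitude D) @ [\<nu>]) = ?l \<otimes>\<^bsub>H\<^esub> \<nu>'"
        using S lw g by (simp add: eval_word_append[OF \<phi>'] l \<nu>_def g_def)
      moreover have "eval_word H \<phi> ([\<nu>] @ emb (longitude D)) = \<nu>' \<otimes>\<^bsub>H\<^esub> ?l"
        by (simp add: l \<nu>_def g_def)
      moreover have "eval_word H \<phi> (replicate n \<nu>) = \<nu>' [^]\<^bsub>H\<^esub> n"
        using g by (simp add: \<nu>_def g_def eval_word_replicate)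
      moreover have "eval_word H \<phi> (emb (meridian D)) = g0"
        using g by (simp add: emb_def meridian_def g_def)
      moreover have "?l \<in> centralizer H \<nu>' \<longleftrightarrow> ?l \<otimes>\<^bsub>H\<^esub> \<nu>' = \<nu>' \<otimes>\<^bsub>H\<^esub> ?l"
        using g p by (simp add: centralizer_def)
      moreover have "(\<forall>(p, q)\<in>map_prod emb emb ` wirtinger_relations D. eval_word H \<phi> p = eval_word H \<phi> q) \<longleftrightarrow>
        (signed H g2 s \<otimes>\<^bsub>H\<^esub> g1 = g0 \<otimes>\<^bsub>H\<^esub> signed H g2 s \<and>
         signed H g0 s \<otimes>\<^bsub>H\<^esub> g2 = g1 \<otimes>\<^bsub>H\<^esub> signed H g0 s \<and>
         signed H g1 s \<otimes>\<^bsub>H\<^esub> g3 = g2 \<otimes>\<^bsub>H\<^esub> signed H g1 s) \<and>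
        (signed H g5 t \<otimes>\<^bsub>H\<^esub> g4 = g3 \<otimes>\<^bsub>H\<^esub> signed H g5 t \<and>
         signed H g3 t \<otimes>\<^bsub>H\<^esub> g5 = g4 \<otimes>\<^bsub>H\<^esub> signed H g3 t \<and>
         signed H g4 t \<otimes>\<^bsub>H\<^esub> g0 = g5 \<otimes>\<^bsub>H\<^esub> signed H g4 t)"
        using g by (simp add: D_def wirtinger_relations_connected_sum_trefoils emb_def g_def)
      ultimately show ?thesis
        using \<phi> by (simp add: satisfying_def R_def ball_Un) metis
    qed
    also have "\<dots> \<longleftrightarrow> g0 = \<nu>' [^]\<^bsub>H\<^esub> n \<and> g3 = \<nu>' [^]\<^bsub>H\<^esub> n \<and>
      g1 = inv\<^bsub>H\<^esub> (signed H g2 s) \<otimes>\<^bsub>H\<^esub> (g0 \<otimes>\<^bsub>H\<^esub> signed H g2 s) \<and>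
      g4 = inv\<^bsub>H\<^esub> (signed H g5 t) \<otimes>\<^bsub>H\<^esub> (g0 \<otimes>\<^bsub>H\<^esub> signed H g5 t) \<and>
      g2 \<in> braid_partners H g0 \<and> g5 \<in> braid_partners H g0 \<and> ?l \<in> centralizer H \<nu>'"
      \<comment> \<open>The second trefoil runs through the arcs 3, 4, 5 and back to 0. Each summand
        forces the arcs 0 and 3 to carry the same element.\<close>
      unfolding trefoil_relations_iff[OF g(2,3,4,5)] trefoil_relations_iff[OF g(5,6,7,2)] by auto
    also have "\<dots> \<longleftrightarrow> g0 = \<nu>' [^]\<^bsub>H\<^esub> n \<and> g3 = \<nu>' [^]\<^bsub>H\<^esub> n \<and>
      g1 = inv\<^bsub>H\<^esub> (signed H g2 s) \<otimes>\<^bsub>H\<^esub> (g0 \<otimes>\<^bsub>H\<^esub> signed H g2 s) \<and>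
      g4 = inv\<^bsub>H\<^esub> (signed H g5 t) \<otimes>\<^bsub>H\<^esub> (g0 \<otimes>\<^bsub>H\<^esub> signed H g5 t) \<and>
      (\<nu>', g2, g5) \<in> root_triples H n s t"
    proof -
      have "?l \<in> centralizer H \<nu>' \<longleftrightarrow>
          signed H (full_twist H g0 g2) s \<otimes>\<^bsub>H\<^esub> signed H (full_twist H g0 g5) t \<in> centralizer H \<nu>'"
        if *: "g0 = \<nu>' [^]\<^bsub>H\<^esub> n" "g3 = g0"
          "g1 = inv\<^bsub>H\<^esub> (signed H g2 s) \<otimes>\<^bsub>H\<^esub> (g0 \<otimes>\<^bsub>H\<^esub> signed H g2 s)"
          "g4 = inv\<^bsub>H\<^esub> (signed H g5 t) \<otimes>\<^bsub>H\<^esub> (g0 \<otimes>\<^bsub>H\<^esub> signed H g5 t)"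
          "g2 \<in> braid_partners H g0" "g5 \<in> braid_partners H g0"
      proof -
        \<comment> \<open>The longitude is \<open>X^s A Y^t B p\<close>, where \<open>A\<close>,
          \<open>B\<close> and \<open>p\<close> are powers of \<open>g0 = \<nu>^n\<close> and hence
          lie in \<open>C\<close>. As \<open>g0\<close> commutes with the full twist
          \<open>Y\<close>, the factor \<open>A\<close> can be moved past it; only
          \<open>X^s Y^t\<close> matters modulo \<open>C\<close>.\<close>
        define C where "C = centralizer H \<nu>'"
        have C: "subgroup C H" unfolding C_def by (rule subgroup_centralizer[OF g(1)])
        define X Y where "X = full_twist H g0 g2" and "Y = full_twist H g0 g5"
        define A B where "A = signed H (g0 \<otimes>\<^bsub>H\<^esub> (g0 \<otimes>\<^bsub>H\<^esub> g0)) (opposite s)"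
          and "B = signed H (g0 \<otimes>\<^bsub>H\<^esub> (g0 \<otimes>\<^bsub>H\<^esub> g0)) (opposite t)"
        have XY: "X \<in> carrier H" "Y \<in> carrier H" "A \<in> carrier H" "B \<in> carrier H"
          using g by (simp_all add: X_def Y_def A_def B_def)
        have "g0 \<in> C"
          using nat_pow_comm[of \<nu>' n 1] g(1,2) by (simp add: C_def centralizer_def *(1))
        then have ABp: "A \<in> C" "B \<in> C" "p \<in> C"
          using C eval_power_word_in_subgroup[OF C, of \<phi> "Some 0"]
          by (cases s; cases t; auto simp: A_def B_def p_def g_def subgroup.m_closed subgroup.m_inv_closed)+
        have sC: "signed H x r \<in> centralizer H y \<longleftrightarrow> x \<in> centralizer H y"
          if "x \<in> carrier H" "y \<in> carrier H" for x y r
          using subgroup.m_inv_closed[OF subgroup_centralizer[OF that(2)]] that(1)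
          by (cases r) (auto, metis inv_inv)
        have Cs: "x \<in> centralizer H y \<longleftrightarrow> y \<in> centralizer H x"
          if "x \<in> carrier H" "y \<in> carrier H" for x y
          using that by (auto simp: centralizer_def)
        have "g0 \<in> centralizer H Y"
          using full_twist_commute[OF g(2) *(6)] g by (simp add: centralizer_def Y_def)
        then have "A \<in> centralizer H Y"
          using subgroup_centralizer[OF XY(2)] g unfolding A_def
          by (subst sC) (auto intro!: subgroup.m_closed XY)
        then have "signed H Y t \<in> centralizer H A" using sC[of Y A t] Cs[of A Y] XY by simp
        then have AY: "signed H Y t \<otimes>\<^bsub>H\<^esub> A = A \<otimes>\<^bsub>H\<^esub> signed H Y t" by (simp add: centralizer_def)
        have "?l = (signed H g2 s \<otimes>\<^bsub>H\<^esub> (signed H g0 s \<otimes>\<^bsub>H\<^esub> signed H g1 s)) \<otimes>\<^bsub>H\<^esub>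
          ((signed H g5 t \<otimes>\<^bsub>H\<^esub> (signed H g3 t \<otimes>\<^bsub>H\<^esub> signed H g4 t)) \<otimes>\<^bsub>H\<^esub> p)"
          using g p by (simp add: m_assoc)
        also have "\<dots> = (signed H X s \<otimes>\<^bsub>H\<^esub> A) \<otimes>\<^bsub>H\<^esub> ((signed H Y t \<otimes>\<^bsub>H\<^esub> B) \<otimes>\<^bsub>H\<^esub> p)"
          unfolding *(2-4) X_def Y_def A_def B_def
          by (simp only: trefoil_longitude[OF g(2) *(5)] trefoil_longitude[OF g(2) *(6)])
        also have "\<dots> = signed H X s \<otimes>\<^bsub>H\<^esub> (A \<otimes>\<^bsub>H\<^esub> signed H Y t) \<otimes>\<^bsub>H\<^esub> (B \<otimes>\<^bsub>H\<^esub> p)"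
          using XY p by (simp add: m_assoc)
        also have "\<dots> = signed H X s \<otimes>\<^bsub>H\<^esub> signed H Y t \<otimes>\<^bsub>H\<^esub> (A \<otimes>\<^bsub>H\<^esub> (B \<otimes>\<^bsub>H\<^esub> p))"
          unfolding AY[symmetric] using XY p by (simp add: m_assoc)
        finally have l: "?l = signed H X s \<otimes>\<^bsub>H\<^esub> signed H Y t \<otimes>\<^bsub>H\<^esub> (A \<otimes>\<^bsub>H\<^esub> (B \<otimes>\<^bsub>H\<^esub> p))" .
        have ABp': "A \<otimes>\<^bsub>H\<^esub> (B \<otimes>\<^bsub>H\<^esub> p) \<in> C" using ABp C by (simp add: subgroup.m_closed)
        have "x \<otimes>\<^bsub>H\<^esub> y \<in> C \<longleftrightarrow> x \<in> C" if "x \<in> carrier H" "y \<in> C" for x y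
        proof
          assume "x \<otimes>\<^bsub>H\<^esub> y \<in> C"
          then have "x \<otimes>\<^bsub>H\<^esub> y \<otimes>\<^bsub>H\<^esub> inv\<^bsub>H\<^esub> y \<in> C" using that C by (simp add: subgroup.m_closed subgroup.m_inv_closed)
          then show "x \<in> C" using that subgroup.mem_carrier[OF C] by (simp add: m_assoc)
        qed (use that C in \<open>simp add: subgroup.m_closed\<close>)
        then show ?thesis
          using ABp' XY unfolding l by (simp add: C_def X_def Y_def)
      qed
      then show ?thesis using g(1) by (auto simp: root_triples_def)
    qed
    finally show ?thesis unfolding g_def .
  qed
  define f where "f = (\<lambda>\<phi> :: nat option \<Rightarrow> 'a. (\<phi> None, \<phi> (Some 2), \<phi> (Some 5)))"
  \<comment> \<open>Entry \<open>i\<close> is the value forced on arc \<open>i\<close>; this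
    rebuilds the assignment from its triple.\<close>
  define arcs where "arcs \<nu> c d = [\<nu> [^]\<^bsub>H\<^esub> n,
      inv\<^bsub>H\<^esub> (signed H c s) \<otimes>\<^bsub>H\<^esub> (\<nu> [^]\<^bsub>H\<^esub> n \<otimes>\<^bsub>H\<^esub> signed H c s), c, \<nu> [^]\<^bsub>H\<^esub> n,
      inv\<^bsub>H\<^esub> (signed H d t) \<otimes>\<^bsub>H\<^esub> (\<nu> [^]\<^bsub>H\<^esub> n \<otimes>\<^bsub>H\<^esub> signed H d t), d]" for \<nu> c d
  define g where "g = (\<lambda>(\<nu>, c, d). \<lambda>x\<in>S. case x of None \<Rightarrow> \<nu> | Some i \<Rightarrow> arcs \<nu> c d ! i)"
  have "bij_betw f (satisfying S R H) (root_triples H n s t)"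
  proof (rule bij_betw_byWitness[where f' = g])
    show "\<forall>\<phi>\<in>satisfying S R H. g (f \<phi>) = \<phi>"
    proof
      fix \<phi> assume \<phi>: "\<phi> \<in> satisfying S R H"
      then have E: "\<phi> \<in> S \<rightarrow>\<^sub>E carrier H" by (simp add: satisfying_def)
      show "g (f \<phi>) = \<phi>"
      proof (rule extensionalityI[of _ S])
        fix x assume x: "x \<in> S"
        show "g (f \<phi>) x = \<phi> x" using S_cases[OF x] S \<phi>[unfolded sat[OF E]]
          by (elim disjE) (simp_all add: g_def f_def arcs_def)
      qed (use E in \<open>auto simp: g_def f_def PiE_def\<close>)
    qed
    show "\<forall>x\<in>root_triples H n s t. f (g x) = x"
      using S by (auto simp: f_def g_def arcs_def)
    show "f ` satisfying S R H \<subseteq> root_triples H n s t"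
    proof (rule image_subsetI)
      fix \<phi> assume \<phi>: "\<phi> \<in> satisfying S R H"
      then have E: "\<phi> \<in> S \<rightarrow>\<^sub>E carrier H" by (simp add: satisfying_def)
      show "f \<phi> \<in> root_triples H n s t" using \<phi>[unfolded sat[OF E]] by (simp add: f_def)
    qed
    show "g ` root_triples H n s t \<subseteq> satisfying S R H"
    proof safe
      fix \<nu> c d assume x: "(\<nu>, c, d) \<in> root_triples H n s t"
      then have "\<nu> \<in> carrier H" "c \<in> carrier H" "d \<in> carrier H"
        by (auto simp: root_triples_def braid_partners_def)
      then have "g (\<nu>, c, d) x \<in> carrier H" if "x \<in> S" for x
        using S_cases[OF that] that by (elim disjE) (simp_all add: g_def arcs_def)
      then have E: "g (\<nu>, c, d) \<in> S \<rightarrow>\<^sub>E carrier H"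
        by (auto simp: g_def)
      show "g (\<nu>, c, d) \<in> satisfying S R H"
        unfolding sat[OF E] using x S by (simp add: g_def arcs_def)
    qed
  qed
  then have "card (satisfying S R H) = card (root_triples H n s t)" by (rule bij_betw_same_card)
  then show ?thesis
    using card_Hom_presented_group[OF assms R_words] by (simp add: K[unfolded D_def])
qed

section \<open>A finite group separating the two knots\<close>

type_synonym matrix = "int \<times> int \<times> int \<times> int"

fun mat_mult :: "int \<Rightarrow> matrix \<Rightarrow> matrix \<Rightarrow> matrix" where
  "mat_mult m (p, q, r, s) (p', q', r', s') =
    ((p * p' + q * r') mod m, (p * q' + q * s') mod m, (r * p' + s * r') mod m, (r * q' + s * s') mod m)"

text \<open>No reduction modulo \<open>m\<close> is made, because the vectors are only fed to
  periodic functions.\<close>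

fun mat_vec :: "matrix \<Rightarrow> int \<times> int \<Rightarrow> int \<times> int" where
  "mat_vec (p, q, r, s) (x, y) = (p * x + q * y, r * x + s * y)"

text \<open>Functions from \<open>(\<int>/m)\<^sup>2\<close> to \<open>\<int>/n\<close>, as periodic functions on pairs of integers.\<close>

definition weights :: "int \<Rightarrow> int \<Rightarrow> (int \<times> int \<Rightarrow> int) set" where
  "weights n m = {w. range w \<subseteq> {0..<n} \<and> (\<forall>x y. w (x mod m, y mod m) = w (x, y))}"

definition matrices :: "int \<Rightarrow> matrix set" where
  "matrices m = {0..<m} \<times> {0..<m} \<times> {0..<m} \<times> {0..<m}"

text \<open>The pair \<open>(w, g)\<close> acts on \<open>(\<int>/m)\<^sup>2 \<times> \<int>/n\<close> by \<open>(u, i) \<mapsto> (g u, i + w u)\<close>.\<close>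

definition wreath_monoid :: "int \<Rightarrow> int \<Rightarrow> ((int \<times> int \<Rightarrow> int) \<times> matrix) monoid" where
  "wreath_monoid n m =
     \<lparr>carrier = weights n m \<times> matrices m,
      monoid.mult = (\<lambda>(w, g) (w', g'). (\<lambda>u. (w' u + w (mat_vec g' u)) mod n, mat_mult m g g')),
      one = (\<lambda>_. 0, (1, 0, 0, 1))\<rparr>"

text \<open>A wreath product: for positive \<open>n\<close> and \<open>m > 1\<close>, a pair is a
  unit exactly if its matrix is invertible modulo \<open>m\<close>.\<close>

definition wreath_group :: "int \<Rightarrow> int \<Rightarrow> ((int \<times> int \<Rightarrow> int) \<times> matrix) monoid" where
  "wreath_group n m = units_of (wreath_monoid n m)"

section \<open>Group laws and finiteness of the wreath product\<close>

lemma mod_dot: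
  fixes m :: int
  shows "(a * (x mod m) + b) mod m = (a * x + b) mod m"
    and "((x mod m) * a + b) mod m = (x * a + b) mod m"
    and "(b + a * (x mod m)) mod m = (b + a * x) mod m"
    and "(b + (x mod m) * a) mod m = (b + x * a) mod m"
  by (metis mod_add_left_eq mod_mult_right_eq) (metis mod_add_left_eq mod_mult_left_eq,
      metis mod_add_right_eq mod_mult_right_eq, metis mod_add_right_eq mod_mult_left_eq)

lemma weights_cong:
  assumes "w \<in> weights n m" "[x = x'] (mod m)" "[y = y'] (mod m)"
  shows "w (x, y) = w (x', y')"
  using assms unfolding weights_def cong_def by (metis (mono_tags, lifting) mem_Collect_eq)

text \<open>The two arguments agree only modulo \<open>m\<close>, which suffices by periodicity;
  associativity of the multiplication rests on this.\<close>

lemma weights_mat_vec_mult: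
  assumes "w \<in> weights n m"
  shows "w (mat_vec (mat_mult m g h) u) = w (mat_vec g (mat_vec h u))"
proof -
  obtain p q r s p' q' r' s' x y where gh: "g = (p, q, r, s)" "h = (p', q', r', s')" "u = (x, y)"
    by (metis prod.exhaust)
  show ?thesis unfolding gh
    by (simp, rule weights_cong[OF assms]; simp add: cong_def mod_simps mod_dot; simp add: algebra_simps)
qed

lemma weights_mat_vec:
  assumes "w \<in> weights n m"
  shows "w (mat_vec g (x mod m, y mod m)) = w (mat_vec g (x, y))"
proof -
  obtain p q r s where g: "g = (p, q, r, s)" by (metis prod.exhaust)
  show ?thesis unfolding g
    by (simp, rule weights_cong[OF assms]; simp add: cong_def mod_simps mod_dot)
qed

lemma mat_mult_assoc: "mat_mult m (mat_mult m f g) h = mat_mult m f (mat_mult m g h)"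
  by (cases f; cases g; cases h) (simp add: mod_simps mod_dot, simp add: algebra_simps)

lemma mat_mult_in_matrices: "m > 0 \<Longrightarrow> mat_mult m g h \<in> matrices m"
  by (cases g; cases h) (simp add: matrices_def)

lemma mat_mult_one:
  "g \<in> matrices m \<Longrightarrow> mat_mult m (1, 0, 0, 1) g = g" "g \<in> matrices m \<Longrightarrow> mat_mult m g (1, 0, 0, 1) = g"
  by (cases g; simp add: matrices_def)+

lemma weights_mult:
  assumes "n > 0" "w \<in> weights n m" "w' \<in> weights n m"
  shows "(\<lambda>u. (w' u + w (mat_vec g u)) mod n) \<in> weights n m"
proof -
  have "w' (x mod m, y mod m) = w' (x, y)" for x y using assms(3) by (simp add: weights_def)
  then show ?thesis using assms(1) weights_mat_vec[OF assms(2)] by (auto simp: weights_def)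
qed

lemma monoid_wreath_monoid:
  assumes "n > 0" "m > 1"
  shows "monoid (wreath_monoid n m)"
proof (rule monoidI)
  fix x y assume "x \<in> carrier (wreath_monoid n m)" "y \<in> carrier (wreath_monoid n m)"
  then show "x \<otimes>\<^bsub>wreath_monoid n m\<^esub> y \<in> carrier (wreath_monoid n m)"
    using assms by (cases x; cases y) (auto simp: wreath_monoid_def weights_mult mat_mult_in_matrices simp del: mat_mult.simps)
next
  show "\<one>\<^bsub>wreath_monoid n m\<^esub> \<in> carrier (wreath_monoid n m)"
    using assms by (auto simp: wreath_monoid_def weights_def matrices_def)
next
  fix x y z assume "x \<in> carrier (wreath_monoid n m)" "y \<in> carrier (wreath_monoid n m)"
    "z \<in> carrier (wreath_monoid n m)"
  then obtain w g w' g' w'' g'' where x: "x = (w, g)" "w \<in> weights n m"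
    and yz: "y = (w', g')" "z = (w'', g'')"
    by (auto simp: wreath_monoid_def)
  show "x \<otimes>\<^bsub>wreath_monoid n m\<^esub> y \<otimes>\<^bsub>wreath_monoid n m\<^esub> z =
      x \<otimes>\<^bsub>wreath_monoid n m\<^esub> (y \<otimes>\<^bsub>wreath_monoid n m\<^esub> z)"
    by (simp add: x(1) yz wreath_monoid_def mat_mult_assoc weights_mat_vec_mult[OF x(2)] mod_simps add.assoc
        del: mat_mult.simps)
next
  fix x assume "x \<in> carrier (wreath_monoid n m)"
  then obtain w g where x: "x = (w, g)" "w \<in> weights n m" "g \<in> matrices m"
    by (auto simp: wreath_monoid_def)
  have "w u \<in> {0..<n}" for u using x(2) unfolding weights_def by blast
  then have "w u mod n = w u" for u by simp
  moreover have "mat_vec (1, 0, 0, 1) u = u" for u by (cases u) simp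
  ultimately show "\<one>\<^bsub>wreath_monoid n m\<^esub> \<otimes>\<^bsub>wreath_monoid n m\<^esub> x = x"
    "x \<otimes>\<^bsub>wreath_monoid n m\<^esub> \<one>\<^bsub>wreath_monoid n m\<^esub> = x"
    using x(3) by (simp_all add: x(1) wreath_monoid_def mat_mult_one del: mat_mult.simps)
qed

text \<open>A periodic function is determined by its restriction to one period.\<close>

lemma finite_wreath_monoid:
  assumes "m > 0"
  shows "finite (carrier (wreath_monoid n m))"
proof -
  let ?B = "{0..<m} \<times> {0..<m}"
  have "inj_on (\<lambda>w. restrict w ?B) (weights n m)"
  proof (rule inj_onI, rule ext)
    fix w w' and u :: "int \<times> int" assume w: "w \<in> weights n m" "w' \<in> weights n m"
      and eq: "restrict w ?B = restrict w' ?B"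
    obtain x y where u: "u = (x, y)" by (cases u)
    have "(x mod m, y mod m) \<in> ?B" using assms by simp
    then have "w (x mod m, y mod m) = w' (x mod m, y mod m)"
      using fun_cong[OF eq] by (metis restrict_apply')
    then show "w u = w' u" using w by (simp add: weights_def u)
  qed
  moreover have "(\<lambda>w. restrict w ?B) ` weights n m \<subseteq> ?B \<rightarrow>\<^sub>E {0..<n}"
    by (rule image_subsetI) (auto simp: weights_def restrict_PiE_iff)
  then have "finite ((\<lambda>w. restrict w ?B) ` weights n m)"
    by (rule finite_subset) (auto intro!: finite_PiE)
  ultimately have "finite (weights n m)" by (metis finite_imageD)
  then show ?thesis by (simp add: wreath_monoid_def matrices_def)
qed

lemma finite_group_wreath_group:
  assumes "n > 0" "m > 1"
  shows "finite_group (wreath_group n m)"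
proof -
  interpret monoid "wreath_monoid n m" by (rule monoid_wreath_monoid[OF assms])
  interpret U: group "wreath_group n m" unfolding wreath_group_def by (rule units_group)
  have "finite (carrier (wreath_group n m))"
    unfolding wreath_group_def units_of_carrier
    by (rule finite_subset[OF _ finite_wreath_monoid[of m n]]) (use assms in \<open>auto simp: Units_def\<close>)
  then show ?thesis by unfold_locales
qed

lemma mult_wreath_group:
  "(w, g) \<otimes>\<^bsub>wreath_group n m\<^esub> (w', g') = (\<lambda>u. (w' u + w (mat_vec g' u)) mod n, mat_mult m g g')"
  by (simp add: wreath_group_def units_of_mult wreath_monoid_def del: mat_mult.simps)

lemma snd_mult_wreath_group: "snd (x \<otimes>\<^bsub>wreath_group n m\<^esub> y) = mat_mult m (snd x) (snd y)"
  by (cases x; cases y) (simp add: mult_wreath_group del: mat_mult.simps)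

lemma one_wreath_group: "\<one>\<^bsub>wreath_group n m\<^esub> = (\<lambda>_. 0, (1, 0, 0, 1))"
  by (simp add: wreath_group_def units_of_one wreath_monoid_def)

lemma wreath_groupI:
  assumes "n > 0" "w \<in> weights n m" "g \<in> matrices m" "h \<in> matrices m"
    and "mat_mult m g h = (1, 0, 0, 1)" "mat_mult m h g = (1, 0, 0, 1)"
  shows "(w, g) \<in> carrier (wreath_group n m)"
proof -
  \<comment> \<open>Weight of the inverse: \<open>h\<close> takes \<open>u\<close> back to the point
    it came from, and the shift made there is undone.\<close>
  let ?w = "\<lambda>u. (- w (mat_vec h u)) mod n"
  have hg: "w (mat_vec h (mat_vec g u)) = w u" for u
    using weights_mat_vec_mult[OF assms(2), of h g u] by (cases u) (simp add: assms(6))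
  have "?w \<in> weights n m"
    using assms(1) weights_mat_vec[OF assms(2)] by (auto simp: weights_def)
  moreover have "(\<lambda>u. (w u + ?w (mat_vec g u)) mod n) = (\<lambda>_. 0)"
    unfolding hg by (simp add: mod_simps)
  moreover have "(\<lambda>u. (?w u + w (mat_vec h u)) mod n) = (\<lambda>_. 0)"
    by (simp add: mod_simps)
  ultimately show ?thesis
    using assms(2-) unfolding wreath_group_def units_of_carrier Units_def wreath_monoid_def
    by (auto simp del: mat_mult.simps intro!: bexI[of _ ?w] bexI[of _ h])
qed

lemma wreath_groupD:
  assumes "x \<in> carrier (wreath_group n m)"
  shows "fst x \<in> weights n m" "snd x \<in> matrices m" "\<exists>h. mat_mult m (snd x) h = (1, 0, 0, 1)"
  using assms unfolding wreath_group_def units_of_carrier Units_def wreath_monoid_def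
  by (auto simp del: mat_mult.simps) blast

section \<open>Full twists of two by two matrices\<close>

lemma snd_full_twist_wreath_group:
  assumes "n > 0" "m > 1" "a \<in> carrier (wreath_group n m)" "c \<in> carrier (wreath_group n m)"
  shows "snd (full_twist (wreath_group n m) a c) =
    (let x = mat_mult m (snd c) (snd a) in mat_mult m (mat_mult m x x) x)"
proof -
  interpret finite_group "wreath_group n m" by (rule finite_group_wreath_group[OF assms(1,2)])
  show ?thesis using assms(3,4)
    by (simp add: full_twist_def numeral_3_eq_3 snd_mult_wreath_group Let_def del: mat_mult.simps)
qed

text \<open>Cayley--Hamilton: \<open>x\<^sup>3 = (T\<^sup>2 - d) x - T d\<close> for trace \<open>T\<close> and determinant \<open>d\<close>.\<close>

lemma mat_cube_scalar:
  assumes "[p + e = t] (mod m)" "[p * e - b * r = t\<^sup>2] (mod m)"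
  shows "mat_mult m (mat_mult m (p, b, r, e) (p, b, r, e)) (p, b, r, e) =
    ((- (t ^ 3)) mod m, 0, 0, (- (t ^ 3)) mod m)"
proof -
  define T d where "T = p + e" and "d = p * e - b * r"
  have Td: "[T = t] (mod m)" "[d = t\<^sup>2] (mod m)" using assms by (simp_all add: T_def d_def)
  \<comment> \<open>For \<open>T = t\<close> and \<open>d = t^2\<close> the coefficient of
    \<open>x\<close> vanishes, so the cube is the scalar \<open>- t^3\<close>.\<close>
  have "[T * T - d = t * t - t\<^sup>2] (mod m)" by (intro cong_diff cong_mult Td)
  then have z: "[T * T - d = 0] (mod m)" by (simp add: power2_eq_square)
  have "[T * d = t * t\<^sup>2] (mod m)" by (intro cong_mult Td)
  then have c: "[T * d = t ^ 3] (mod m)" by (simp add: power2_eq_square power3_eq_cube mult.assoc)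
  have diag: "[(T * T - d) * v - T * d = - (t ^ 3)] (mod m)" for v
    using cong_diff[OF cong_mult[OF z cong_refl[of v]] c] by simp
  have off: "[(T * T - d) * v = 0] (mod m)" for v
    using cong_mult[OF z cong_refl[of v]] by simp
  have "((p * p + b * r) * p + (p * b + b * e) * r) mod m = (- (t ^ 3)) mod m"
    using diag[of p] by (simp add: cong_def T_def d_def algebra_simps)
  moreover have "((p * p + b * r) * b + (p * b + b * e) * e) mod m = 0"
    using off[of b] by (simp add: cong_def T_def d_def algebra_simps)
  moreover have "((r * p + e * r) * p + (r * b + e * e) * r) mod m = 0"
    using off[of r] by (simp add: cong_def T_def d_def algebra_simps)
  moreover have "((r * p + e * r) * b + (r * b + e * e) * e) mod m = (- (t ^ 3)) mod m"
    using diag[of e] by (simp add: cong_def T_def d_def algebra_simps)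
  ultimately show ?thesis by (simp add: mod_simps mod_dot)
qed

lemma cong_mult_cancel_prime:
  fixes m :: int
  assumes "prime m" "\<not> [k = 0] (mod m)" "[k * x = k * y] (mod m)"
  shows "[x = y] (mod m)"
  using assms by (metis cong_0_iff cong_mult_lcancel prime_imp_coprime coprime_commute)

text \<open>Over the field \<open>\<int>/m\<close>, a braid partner of \<open>diag(1, \<mu>)\<close> is either diagonal, or its product
  with \<open>diag(1, \<mu>)\<close> has trace \<open>\<mu>\<close> and determinant \<open>\<mu>\<^sup>2\<close>.\<close>

lemma braid_partner_first_column:
  fixes m \<mu> :: int
  assumes m: "prime m" and \<mu>: "\<not> [\<mu> = 0] (mod m)" "\<not> [\<mu> = 1] (mod m)"
    and inv: "mat_mult m (p, q, r, s) h = (1, 0, 0, 1)"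
    and braid: "mat_mult m (mat_mult m (1, 0, 0, \<mu>) (p, q, r, s)) (1, 0, 0, \<mu>) =
      mat_mult m (mat_mult m (p, q, r, s) (1, 0, 0, \<mu>)) (p, q, r, s)"
    and x: "x = mat_mult m (p, q, r, s) (1, 0, 0, \<mu>)"
  shows "\<exists>b e. mat_mult m (mat_mult m x x) x = (1, b, 0, e) \<or>
    mat_mult m (mat_mult m x x) x = ((- (\<mu> ^ 3)) mod m, b, 0, e)"
proof -
  have m1: "m > 1" using m by (simp add: prime_gt_1_int)
  \<comment> \<open>The four entries of the braid relation. By \<open>e2\<close> and
    \<open>e3\<close>, the number \<open>p + \<mu> s - \<mu>\<close> annihilates \<open>q\<close>
    and \<open>r\<close>, hence the case distinction on the trace below.\<close>
  have e1: "[p = p * p + \<mu> * q * r] (mod m)"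
    and e2: "[\<mu> * q = q * (p + \<mu> * s)] (mod m)"
    and e3: "[\<mu> * r = r * (p + \<mu> * s)] (mod m)"
    and e4: "[\<mu> * \<mu> * s = q * r + \<mu> * s * s] (mod m)"
    using braid by (simp_all add: cong_def mod_simps mod_dot algebra_simps)
  have cube: "mat_mult m (mat_mult m x x) x =
      mat_mult m (mat_mult m (p, q * \<mu>, r, s * \<mu>) (p, q * \<mu>, r, s * \<mu>)) (p, q * \<mu>, r, s * \<mu>)"
    by (simp add: x mod_simps mod_dot)
  show ?thesis
  proof (cases "[p + s * \<mu> = \<mu>] (mod m)")
    case True
    have "[\<mu> = p + \<mu> * s] (mod m)" using True by (simp add: cong_sym mult.commute)
    then have p: "[p = \<mu> - \<mu> * s] (mod m)"
      by (metis add_diff_cancel_right' cong_diff cong_refl cong_sym)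
    \<comment> \<open>With \<open>p\<close> eliminated, \<open>e1\<close> and \<open>e4\<close> give
      two values of \<open>q r\<close>. Comparing them yields \<open>s (1 - \<mu>) = 1\<close>,
      which fixes the determinant.\<close>
    have "[p - p * p = \<mu> * q * r] (mod m)"
      using cong_diff[OF e1 cong_refl[of "p * p"]] by simp
    moreover have "[p - p * p = (\<mu> - \<mu> * s) - (\<mu> - \<mu> * s) * (\<mu> - \<mu> * s)] (mod m)"
      by (intro cong_diff cong_mult p)
    ultimately have "[\<mu> * ((1 - s) * (1 - \<mu> + \<mu> * s)) = \<mu> * (q * r)] (mod m)"
      by (simp add: cong_def algebra_simps)
    then have qr: "[(1 - s) * (1 - \<mu> + \<mu> * s) = q * r] (mod m)"
      by (rule cong_mult_cancel_prime[OF m \<mu>(1)])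
    have qr': "[\<mu> * \<mu> * s - \<mu> * s * s = q * r] (mod m)"
      using cong_diff[OF e4 cong_refl[of "\<mu> * s * s"]] by simp
    have "[(1 - s) * (1 - \<mu> + \<mu> * s) - (\<mu> * \<mu> * s - \<mu> * s * s) = 0] (mod m)"
      using cong_diff[OF qr qr'] by simp
    then have "[(1 - \<mu>) * 1 - (1 - \<mu>) * (s * (1 - \<mu>)) = 0] (mod m)"
      by (simp add: algebra_simps)
    then have "[(1 - \<mu>) * (s * (1 - \<mu>)) = (1 - \<mu>) * 1] (mod m)"
      by (metis cong_diff_iff_cong_0 cong_sym)
    moreover have "\<not> [1 - \<mu> = 0] (mod m)" using \<mu>(2) by (metis cong_diff_iff_cong_0 cong_sym)
    ultimately have s: "[s * (1 - \<mu>) = 1] (mod m)" by (metis cong_mult_cancel_prime[OF m])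
    have "[p * s - q * r = (\<mu> - \<mu> * s) * s - (\<mu> * \<mu> * s - \<mu> * s * s)] (mod m)"
      by (intro cong_diff cong_mult p cong_refl cong_sym[OF qr'])
    also have "(\<mu> - \<mu> * s) * s - (\<mu> * \<mu> * s - \<mu> * s * s) = \<mu> * (s * (1 - \<mu>))"
      by (simp add: algebra_simps)
    also have "[\<mu> * (s * (1 - \<mu>)) = \<mu> * 1] (mod m)" by (intro cong_mult s cong_refl)
    finally have "[\<mu> * (p * s - q * r) = \<mu> * (\<mu> * 1)] (mod m)" by (intro cong_mult cong_refl)
    then have "[p * (s * \<mu>) - q * \<mu> * r = \<mu>\<^sup>2] (mod m)"
      by (simp add: algebra_simps power2_eq_square)
    from mat_cube_scalar[OF True this] show ?thesis unfolding cube by blast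
  next
    case False
    then have ne: "\<not> [p + \<mu> * s - \<mu> = 0] (mod m)"
      by (metis cong_diff_iff_cong_0 mult.commute)
    have "[(p + \<mu> * s - \<mu>) * q = (p + \<mu> * s - \<mu>) * 0] (mod m)"
      using cong_diff[OF cong_sym[OF e2] cong_refl[of "\<mu> * q"]] by (simp add: algebra_simps)
    then have q: "[q = 0] (mod m)" by (rule cong_mult_cancel_prime[OF m ne])
    have "[(p + \<mu> * s - \<mu>) * r = (p + \<mu> * s - \<mu>) * 0] (mod m)"
      using cong_diff[OF cong_sym[OF e3] cong_refl[of "\<mu> * r"]] by (simp add: algebra_simps)
    then have r: "[r = 0] (mod m)" by (rule cong_mult_cancel_prime[OF m ne])
    obtain p' q' r' s' where h: "h = (p', q', r', s')" by (metis prod.exhaust)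
    have pp': "[p * p' + q * r' = 1] (mod m)" using inv m1 by (simp add: h cong_def)
    \<comment> \<open>In the diagonal case \<open>e1\<close> reads \<open>p = p^2\<close>;
      invertibility excludes \<open>p = 0\<close>, so \<open>p = 1\<close> and the cube fixes the
      first basis vector.\<close>
    have "\<not> [p = 0] (mod m)"
    proof
      assume p: "[p = 0] (mod m)"
      have "[p * p' + q * r' = 0 * p' + 0 * r'] (mod m)"
        by (intro cong_add cong_mult p q cong_refl)
      then have "[1 = 0] (mod m)" using cong_trans[OF cong_sym[OF pp']] by simp
      then show False using m1 by (simp add: cong_def)
    qed
    moreover have "[p * p + \<mu> * q * r = p * p + \<mu> * 0 * 0] (mod m)"
      by (intro cong_add cong_mult q r cong_refl)
    then have "[p * 1 = p * p] (mod m)" using cong_trans[OF e1] by simp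
    ultimately have "[1 = p] (mod m)" by (metis cong_mult_cancel_prime[OF m])
    then have p: "[p = 1] (mod m)" by (rule cong_sym)
    have "[(p * p + q * \<mu> * r) * p + (p * (q * \<mu>) + q * \<mu> * (s * \<mu>)) * r
        = (1 * 1 + 0 * \<mu> * 0) * 1 + (1 * (0 * \<mu>) + 0 * \<mu> * (s * \<mu>)) * 0] (mod m)"
      by (intro cong_add cong_mult p q r cong_refl)
    then have "((p * p + q * \<mu> * r) * p + (p * (q * \<mu>) + q * \<mu> * (s * \<mu>)) * r) mod m = 1"
      using m1 by (simp add: cong_def)
    moreover have "[(r * p + s * \<mu> * r) * p + (r * (q * \<mu>) + s * \<mu> * (s * \<mu>)) * r
        = (0 * p + s * \<mu> * 0) * p + (0 * (q * \<mu>) + s * \<mu> * (s * \<mu>)) * 0] (mod m)"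
      by (intro cong_add cong_mult r cong_refl)
    then have "((r * p + s * \<mu> * r) * p + (r * (q * \<mu>) + s * \<mu> * (s * \<mu>)) * r) mod m = 0"
      by (simp add: cong_def)
    moreover obtain p3 b e r3 where x3: "mat_mult m (mat_mult m x x) x = (p3, b, r3, e)"
      by (metis prod.exhaust)
    ultimately have "p3 = 1" "r3 = 0" using x3[unfolded cube] by (auto simp: mod_simps mod_dot)
    then show ?thesis using x3 by blast
  qed
qed

text \<open>As 2 is invertible modulo \<open>m\<close>, the matrix diag(1, 2) maps only
  \<open>(1, 0)\<close> to itself among all vectors with image \<open>(1, 0)\<close>. So \<delta> is
  invariant, and the weight of the power is \<open>n\<close> \<delta>, which is zero modulo
  \<open>n\<close>. The bound on \<open>m\<close> makes \<open>2^n\<close> its own residue.\<close>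

lemma wreath_group_root:
  fixes n :: nat and m :: int
  assumes n: "n \<ge> 2" and m: "prime m" "m > 64 ^ n"
  defines "H \<equiv> wreath_group (int n) m"
  defines "\<delta> \<equiv> \<lambda>(x, y). if x mod m = 1 \<and> y mod m = 0 then 1 else 0"
  shows "(\<delta>, (1, 0, 0, 2)) \<in> carrier H"
    and "(\<delta>, (1, 0, 0, 2)) [^]\<^bsub>H\<^esub> n = (\<lambda>_. 0, (1, 0, 0, 2 ^ n))"
proof -
  have "(2::int) ^ n < m"
    using m(2) power_mono[of 2 "64::int" n] by simp
  moreover have "(2::int) ^ 2 \<le> 2 ^ n" using n by (intro power_increasing) auto
  ultimately have m2: "m > 2" "2 ^ n < m" by auto
  interpret finite_group H
    unfolding H_def by (rule finite_group_wreath_group) (use n m2 in auto)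
  have odd: "coprime 2 m" using m(1) m2 by (meson coprime_commute not_less prime_imp_coprime zdvd_imp_le zero_less_numeral)
  then obtain h where "[2 * h = 1] (mod m)" using cong_solve_coprime_int by blast
  then have h: "2 * h mod m = 1" "h * 2 mod m = 1"
    using m2 by (simp_all add: cong_def mult.commute)
  have "range \<delta> \<subseteq> {0..<int n}" using n by (auto simp: \<delta>_def)
  then have \<delta>: "\<delta> \<in> weights (int n) m" by (simp add: weights_def) (simp add: \<delta>_def)
  show "(\<delta>, (1, 0, 0, 2)) \<in> carrier H"
    unfolding H_def
  proof (rule wreath_groupI[OF _ \<delta>, where h = "(1, 0, 0, h mod m)"])
    show "mat_mult m (1, 0, 0, 2) (1, 0, 0, h mod m) = (1, 0, 0, 1)"
      "mat_mult m (1, 0, 0, h mod m) (1, 0, 0, 2) = (1, 0, 0, 1)"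
      using h m2 by (simp_all add: mod_simps)
  qed (use n m2 in \<open>auto simp: matrices_def\<close>)
  have \<delta>2: "\<delta> (mat_vec (1, 0, 0, 2) u) = \<delta> u" for u
  proof -
    obtain x y where u: "u = (x, y)" by (cases u)
    have "m dvd 2 * y \<longleftrightarrow> m dvd y"
      using odd by (simp add: coprime_commute coprime_dvd_mult_right_iff)
    then show ?thesis by (simp add: u \<delta>_def mod_eq_0_iff_dvd)
  qed
  have "(\<delta>, (1, 0, 0, 2)) [^]\<^bsub>H\<^esub> k = (\<lambda>u. int k * \<delta> u mod int n, (1, 0, 0, 2 ^ k mod m))" for k
  proof (induction k)
    case 0
    show ?case using m2 by (simp add: H_def one_wreath_group)
  next
    case (Suc k)
    have "(\<lambda>u. (\<delta> u + int k * \<delta> (mat_vec (1, 0, 0, 2) u) mod int n) mod int n)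
        = (\<lambda>u. int (Suc k) * \<delta> u mod int n)"
      unfolding \<delta>2 by (simp add: mod_simps algebra_simps)
    then show ?case
      using m2 by (simp add: Suc) (simp add: H_def mult_wreath_group mod_simps mult.commute)
  qed
  then show "(\<delta>, (1, 0, 0, 2)) [^]\<^bsub>H\<^esub> n = (\<lambda>_. 0, (1, 0, 0, 2 ^ n))"
    using m2 by simp
qed

lemma mat_mult_mod:
  "mat_mult m (p mod m, q mod m, r mod m, s mod m) h = mat_mult m (p, q, r, s) h"
  "mat_mult m h (p mod m, q mod m, r mod m, s mod m) = mat_mult m h (p, q, r, s)"
  by (cases h; simp add: mod_simps mod_dot)+

lemma braid_partner_witness:
  fixes m \<mu> :: int
  assumes m: "prime m" and \<mu>: "\<not> [\<mu> = 0] (mod m)" "\<not> [\<mu> = 1] (mod m)"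
  obtains g h where "g \<in> matrices m" "h \<in> matrices m"
    and "mat_mult m g h = (1, 0, 0, 1)" "mat_mult m h g = (1, 0, 0, 1)"
    and "mat_mult m (mat_mult m (1, 0, 0, \<mu>) g) (1, 0, 0, \<mu>) = mat_mult m (mat_mult m g (1, 0, 0, \<mu>)) g"
    and "let x = mat_mult m g (1, 0, 0, \<mu>) in
      mat_mult m (mat_mult m x x) x = ((- (\<mu> ^ 3)) mod m, 0, 0, (- (\<mu> ^ 3)) mod m)"
proof -
  have m1: "m > 1" using m by (simp add: prime_gt_1_int)
  have unit: "\<exists>y. [k * y = 1] (mod m)" if "\<not> [k = 0] (mod m)" for k
    using that m by (metis cong_0_iff cong_solve_coprime_int coprime_commute prime_imp_coprime)
  obtain \<kappa> where \<kappa>: "[\<mu> * \<kappa> = 1] (mod m)" using unit[OF \<mu>(1)] by blast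
  have "\<not> [1 - \<mu> = 0] (mod m)" using \<mu>(2) by (metis cong_diff_iff_cong_0 cong_sym)
  then obtain s where "[(1 - \<mu>) * s = 1] (mod m)" using unit by blast
  then have s: "[s * (1 - \<mu>) = 1] (mod m)" by (simp add: mult.commute)
  \<comment> \<open>The upper right entry of the witness is 1. Then \<open>p\<close> is chosen to
    make the trace of \<open>g\<close> diag(1, \<mu>) equal to \<mu>, and \<open>r\<close> solves
    the lower right entry of the braid relation.\<close>
  define p r where "p = \<mu> * (1 - s)" and "r = \<mu> * s * (\<mu> - s)"
  have "p * s - r = \<mu> * (s * (1 - \<mu>))" by (simp add: p_def r_def algebra_simps)
  also have "[\<mu> * (s * (1 - \<mu>)) = \<mu> * 1] (mod m)" by (intro cong_mult s cong_refl)
  finally have det: "[p * s - r = \<mu>] (mod m)" by simp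
  have "[(p * s - r) * \<kappa> = \<mu> * \<kappa>] (mod m)" by (intro cong_mult det cong_refl)
  then have det\<kappa>: "((p * s - r) * \<kappa>) mod m = 1" using \<kappa> m1 by (simp add: cong_def)
  have "p * p + \<mu> * r - p = \<mu> * (1 - \<mu>) * (s * (1 - \<mu>) - 1)"
    by (simp add: p_def r_def algebra_simps)
  also have "[\<mu> * (1 - \<mu>) * (s * (1 - \<mu>) - 1) = \<mu> * (1 - \<mu>) * (1 - 1)] (mod m)"
    by (intro cong_mult cong_diff s cong_refl)
  finally have e1: "[p * p + \<mu> * r = p] (mod m)" by (simp add: cong_diff_iff_cong_0)
  have tr: "p + s * \<mu> = \<mu>" and e4: "r + s * \<mu> * s = \<mu> * s * \<mu>"
    by (simp_all add: p_def r_def algebra_simps)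
  have "[\<mu> * (p * s - r) = \<mu> * \<mu>] (mod m)" by (intro cong_mult det cong_refl)
  then have det2: "[p * (s * \<mu>) - \<mu> * r = \<mu>\<^sup>2] (mod m)"
    by (simp add: algebra_simps power2_eq_square)
  \<comment> \<open>The determinant of \<open>g\<close> is \<mu>, so its inverse is \<kappa> times
    the adjugate.\<close>
  define g h where "g = (p mod m, 1 mod m, r mod m, s mod m)"
    and "h = ((s * \<kappa>) mod m, (- \<kappa>) mod m, (- r * \<kappa>) mod m, (p * \<kappa>) mod m)"
  show ?thesis
  proof (rule that[of g h])
    show "g \<in> matrices m" "h \<in> matrices m"
      using m1 by (simp_all add: g_def h_def matrices_def)
    show "mat_mult m g h = (1, 0, 0, 1)" "mat_mult m h g = (1, 0, 0, 1)"
      unfolding g_def h_def mat_mult_mod using det\<kappa> by (simp_all add: algebra_simps)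
    have ga: "mat_mult m g (1, 0, 0, \<mu>) = (p mod m, \<mu> mod m, r mod m, (s * \<mu>) mod m)"
      by (simp add: g_def mod_simps)
    have "mat_mult m (1, 0, 0, \<mu>) g = (p mod m, 1 mod m, (\<mu> * r) mod m, (\<mu> * s) mod m)"
      by (simp add: g_def mod_simps)
    moreover have "(r * p + s * \<mu> * r) = r * \<mu>"
      using tr by (metis distrib_left mult.commute)
    ultimately show "mat_mult m (mat_mult m (1, 0, 0, \<mu>) g) (1, 0, 0, \<mu>) =
        mat_mult m (mat_mult m g (1, 0, 0, \<mu>)) g"
      unfolding ga unfolding g_def mat_mult_mod using e1 tr e4
      by (simp add: cong_def mult.commute mod_simps)
    show "let x = mat_mult m g (1, 0, 0, \<mu>) in
      mat_mult m (mat_mult m x x) x = ((- (\<mu> ^ 3)) mod m, 0, 0, (- (\<mu> ^ 3)) mod m)"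
      unfolding ga Let_def mat_mult_mod using mat_cube_scalar[OF _ det2] tr by simp
  qed
qed

lemma wreath_group_separates:
  fixes n :: nat and m :: int
  assumes n: "n \<ge> 2" and m: "prime m" "m > 64 ^ n"
  defines "H \<equiv> wreath_group (int n) m"
  shows "card (root_triples H n Positive Positive) < card (root_triples H n Negative Positive)"
proof -
  define \<mu> :: int where "\<mu> = 2 ^ n"
  \<comment> \<open>The source of the bound \<open>64^n = \<mu>^6\<close>: the numbers
    \<open>\<mu>^3 + 1\<close> and \<open>\<mu>^6 - 1\<close> are positive and less than
    \<open>m\<close>, so neither \<open>- \<mu>^3\<close> nor \<open>\<mu>^6\<close> is 1 modulo
    \<open>m\<close>.\<close>
  have "\<mu> ^ 3 * \<mu> ^ 3 = (2 ^ 6) ^ n"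
    unfolding \<mu>_def power_mult[symmetric] power_add[symmetric] by (simp add: mult.commute)
  then have six: "\<mu> ^ 3 * \<mu> ^ 3 = 64 ^ n" by simp
  have \<mu>1: "\<mu> > 1" unfolding \<mu>_def using n by (intro one_less_power) auto
  then have \<mu>3: "\<mu> ^ 3 \<ge> 2" using one_less_power[of \<mu> 3] by linarith
  then have "\<mu> ^ 3 * 2 \<le> \<mu> ^ 3 * \<mu> ^ 3" by (intro mult_left_mono) (use \<mu>3 in linarith)+
  then have \<mu>m: "\<mu> ^ 3 + 1 < m" using m(2) six \<mu>3 by linarith
  moreover have "\<mu> ^ 1 \<le> \<mu> ^ 3" using \<mu>1 by (intro power_increasing) auto
  ultimately have "\<mu> < m" by simp
  then have \<mu>: "\<not> [\<mu> = 0] (mod m)" "\<not> [\<mu> = 1] (mod m)"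
    using \<mu>1 by (auto simp: cong_def)
  have m1: "m > 1" "n > 0" using n \<mu>1 \<open>\<mu> < m\<close> by auto
  interpret finite_group H
    unfolding H_def by (rule finite_group_wreath_group) (use m1 in auto)
  define \<delta> :: "int \<times> int \<Rightarrow> int" where "\<delta> = (\<lambda>(x, y). if x mod m = 1 \<and> y mod m = 0 then 1 else 0)"
  define \<nu> where "\<nu> = (\<delta>, (1, 0, 0, 2) :: matrix)"
  have \<nu>: "\<nu> \<in> carrier H" and a: "\<nu> [^]\<^bsub>H\<^esub> n = (\<lambda>_. 0, (1, 0, 0, \<mu>))"
    using wreath_group_root[OF n m] unfolding H_def \<nu>_def \<delta>_def \<mu>_def by auto
  define k where "k = (- (\<mu> ^ 3)) mod m"
  obtain g h where g: "g \<in> matrices m" "h \<in> matrices m"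
    "mat_mult m g h = (1, 0, 0, 1)" "mat_mult m h g = (1, 0, 0, 1)"
    "mat_mult m (mat_mult m (1, 0, 0, \<mu>) g) (1, 0, 0, \<mu>) = mat_mult m (mat_mult m g (1, 0, 0, \<mu>)) g"
    "let x = mat_mult m g (1, 0, 0, \<mu>) in mat_mult m (mat_mult m x x) x = (k, 0, 0, k)"
    using braid_partner_witness[OF m(1) \<mu>] unfolding k_def by metis
  define c where "c = ((\<lambda>_. 0) :: int \<times> int \<Rightarrow> int, g)"
  have zero: "(\<lambda>_. 0) \<in> weights (int n) m" using m1 by (auto simp: weights_def)
  have c: "c \<in> carrier H"
    unfolding H_def c_def by (rule wreath_groupI[OF _ zero g(1-4)]) (use m1 in simp)
  show ?thesis
  proof (rule card_root_triples_less[OF \<nu>])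
    show "c \<in> braid_partners H (\<nu> [^]\<^bsub>H\<^esub> n)"
      unfolding braid_partners_def a using c g(5)
      by (simp add: c_def H_def mult_wreath_group del: mat_mult.simps)
    fix f assume f: "f \<in> braid_partners H (\<nu> [^]\<^bsub>H\<^esub> n)"
    then have fc: "f \<in> carrier H" by (simp add: braid_partners_def)
    have ac: "\<nu> [^]\<^bsub>H\<^esub> n \<in> carrier H" using \<nu> by simp
    have "snd (\<nu> [^]\<^bsub>H\<^esub> n \<otimes>\<^bsub>H\<^esub> f \<otimes>\<^bsub>H\<^esub> \<nu> [^]\<^bsub>H\<^esub> n) = snd (f \<otimes>\<^bsub>H\<^esub> \<nu> [^]\<^bsub>H\<^esub> n \<otimes>\<^bsub>H\<^esub> f)"
      using f by (simp add: braid_partners_def)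
    then have br: "mat_mult m (mat_mult m (1, 0, 0, \<mu>) (snd f)) (1, 0, 0, \<mu>) =
        mat_mult m (mat_mult m (snd f) (1, 0, 0, \<mu>)) (snd f)"
      unfolding H_def snd_mult_wreath_group a[unfolded H_def] by simp
    obtain p q r s where pqrs: "snd f = (p, q, r, s)" by (metis prod.exhaust)
    obtain h' where h': "mat_mult m (p, q, r, s) h' = (1, 0, 0, 1)"
      using wreath_groupD(3)[OF fc[unfolded H_def]] unfolding pqrs by blast
    have "snd (full_twist H (\<nu> [^]\<^bsub>H\<^esub> n) f) =
        (let x = mat_mult m (p, q, r, s) (1, 0, 0, \<mu>) in mat_mult m (mat_mult m x x) x)"
      using snd_full_twist_wreath_group[OF _ m1(1) ac[unfolded H_def] fc[unfolded H_def]] m1(2)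
      by (simp add: H_def[symmetric] a pqrs del: mat_mult.simps)
    then obtain v b e where v: "snd (full_twist H (\<nu> [^]\<^bsub>H\<^esub> n) f) = (v, b, 0, e)" "v = 1 \<or> v = k"
      using braid_partner_first_column[OF m(1) \<mu> h' br[unfolded pqrs] HOL.refl]
      unfolding k_def Let_def by metis
    have "snd (full_twist H (\<nu> [^]\<^bsub>H\<^esub> n) c) = (k, 0, 0, k)"
      using snd_full_twist_wreath_group[OF _ m1(1) ac[unfolded H_def] c[unfolded H_def]] m1(2) g(6)
      by (simp add: H_def[symmetric] a c_def Let_def del: mat_mult.simps)
    moreover define z where "z = full_twist H (\<nu> [^]\<^bsub>H\<^esub> n) c \<otimes>\<^bsub>H\<^esub> full_twist H (\<nu> [^]\<^bsub>H\<^esub> n) f"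
    ultimately have "snd z = mat_mult m (k, 0, 0, k) (v, b, 0, e)"
      by (simp only: H_def snd_mult_wreath_group v(1)[unfolded H_def])
    then obtain w b' e' where z: "z = (w, (k * v mod m, b', 0, e'))"
      by (cases z) auto
    show "z \<notin> centralizer H \<nu>"
    proof
      assume "z \<in> centralizer H \<nu>"
      \<comment> \<open>Compare weights at \<open>(1, 0)\<close>. It is fixed by diag(1, 2), so the
        weight of \<open>z\<close> cancels; what remains says that \<open>z\<close> fixes
        \<open>(1, 0)\<close>, because 0 and 1 differ modulo \<open>n\<close>.\<close>
      then have "fst (z \<otimes>\<^bsub>H\<^esub> \<nu>) (1, 0) = fst (\<nu> \<otimes>\<^bsub>H\<^esub> z) (1, 0)" by (simp add: centralizer_def)
      then have "(\<delta> (1, 0) + w (1, 0)) mod int n = (w (1, 0) + \<delta> (k * v mod m, 0)) mod int n"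
        by (simp add: z \<nu>_def H_def mult_wreath_group)
      then have "[w (1, 0) + \<delta> (1, 0) = w (1, 0) + \<delta> (k * v mod m, 0)] (mod int n)"
        by (simp add: cong_def add.commute)
      then have "[\<delta> (1, 0) = \<delta> (k * v mod m, 0)] (mod int n)" by (simp add: cong_add_lcancel)
      then have "[k * v = 1] (mod m)"
        using m1 n by (auto simp: \<delta>_def cong_def split: if_splits)
      consider "[- (\<mu> ^ 3) = 1] (mod m)" | "[\<mu> ^ 3 * \<mu> ^ 3 = 1] (mod m)"
      proof -
        have k: "[- (\<mu> ^ 3) = k] (mod m)" by (simp add: k_def cong_def)
        have "[- (\<mu> ^ 3) * - (\<mu> ^ 3) = k * k] (mod m)" by (intro cong_mult k)
        then show ?thesis
          using v(2) \<open>[k * v = 1] (mod m)\<close> k that cong_trans by (metis minus_mult_minus mult.right_neutral)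
      qed
      then show False
      proof cases
        case 1
        then have "m dvd \<mu> ^ 3 + 1"
          by (metis cong_iff_dvd_diff dvd_minus_iff minus_diff_eq diff_minus_eq_add add.commute)
        then show False using \<mu>m \<mu>3 zdvd_imp_le[of m "\<mu> ^ 3 + 1"] by linarith
      next
        case 2
        then have "m dvd 64 ^ n - 1" by (simp only: six cong_iff_dvd_diff)
        moreover have "(64::int) ^ n > 1" using m1 by (intro one_less_power) auto
        ultimately show False using m(2) zdvd_imp_le[of m "64 ^ n - 1"] by linarith
      qed
    qed
  qed
qed

section \<open>Transport along isomorphisms\<close>

text \<open>Composing with an injective homomorphism is injective on homomorphisms. Finiteness is
  assumed because \<open>card\<close> of an infinite set is 0.\<close>

lemma card_Hom_le_inj:
  assumes "group G" and h: "h \<in> hom H K" "inj_on h (carrier H)" and fin: "finite (Hom G K)"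
  shows "card (Hom G H) \<le> card (Hom G K)"
proof (rule card_inj_on_le[OF _ _ fin])
  interpret G: group G by (rule assms(1))
  show "(\<lambda>\<phi>. compose (carrier G) h \<phi>) ` Hom G H \<subseteq> Hom G K"
    using h(1) by (auto simp: Hom_def hom_def compose_def Pi_iff)
  show "inj_on (\<lambda>\<phi>. compose (carrier G) h \<phi>) (Hom G H)"
  proof (rule inj_onI)
    fix \<phi> \<psi> assume \<phi>: "\<phi> \<in> Hom G H" "\<psi> \<in> Hom G H"
      and eq: "compose (carrier G) h \<phi> = compose (carrier G) h \<psi>"
    have "\<phi> x = \<psi> x" if x: "x \<in> carrier G" for x
      using fun_cong[OF eq, of x] x \<phi> h(2) by (auto simp: Hom_def hom_def compose_def Pi_iff inj_on_def)
    then show "\<phi> = \<psi>" using \<phi> by (auto simp: Hom_def intro: extensionalityI)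
  qed
qed

lemma card_Hom_le_surj:
  assumes "group G'" and i: "i \<in> hom G' G" "i ` carrier G' = carrier G" and fin: "finite (Hom G' H)"
  shows "card (Hom G H) \<le> card (Hom G' H)"
proof (rule card_inj_on_le[OF _ _ fin])
  interpret G': group G' by (rule assms(1))
  show "(\<lambda>\<phi>. compose (carrier G') \<phi> i) ` Hom G H \<subseteq> Hom G' H"
  proof (rule image_subsetI)
    fix \<phi> assume "\<phi> \<in> Hom G H"
    then have \<phi>: "\<phi> \<in> hom G H" by (simp add: Hom_def)
    have "compose (carrier G') \<phi> i \<in> hom G' H"
      by (rule homI) (simp_all add: compose_eq hom_in_carrier[OF i(1)] hom_in_carrier[OF \<phi>]
          hom_mult[OF i(1)] hom_mult[OF \<phi>])
    then show "compose (carrier G') \<phi> i \<in> Hom G' H" by (simp add: Hom_def compose_def)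
  qed
  show "inj_on (\<lambda>\<phi>. compose (carrier G') \<phi> i) (Hom G H)"
  proof (rule inj_onI)
    fix \<phi> \<psi> assume \<phi>: "\<phi> \<in> Hom G H" "\<psi> \<in> Hom G H"
      and eq: "compose (carrier G') \<phi> i = compose (carrier G') \<psi> i"
    have "\<phi> x = \<psi> x" if "x \<in> carrier G" for x
    proof -
      have "x \<in> i ` carrier G'" using that by (simp only: i(2))
      then obtain y where "y \<in> carrier G'" "x = i y" by (rule imageE)
      then show ?thesis using fun_cong[OF eq, of y] by (simp add: compose_eq)
    qed
    then show "\<phi> = \<psi>" using \<phi> by (auto simp: Hom_def intro: extensionalityI)
  qed
qed

text \<open>Moves the separating group onto natural numbers, so that the carrier type of
  \<open>H\<close> does not depend on the construction.\<close>

lemma finite_group_iso_nat: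
  assumes "group G" "finite (carrier G)"
  obtains H :: "nat monoid" and f where "group H" "finite (carrier H)" "f \<in> iso G H"
proof -
  obtain f :: "'a \<Rightarrow> nat" where f: "inj_on f (carrier G)"
    using finite_imp_inj_to_nat_seg[OF assms(2)] by blast
  interpret group G by (rule assms(1))
  define H where "H = \<lparr>carrier = f ` carrier G,
    monoid.mult = (\<lambda>x y. f (inv_into (carrier G) f x \<otimes>\<^bsub>G\<^esub> inv_into (carrier G) f y)),
    one = f \<one>\<^bsub>G\<^esub>\<rparr>"
  have iso: "f \<in> iso G H"
    using f by (auto simp: iso_def hom_def H_def bij_betw_def)
  have "group (H\<lparr>one := f \<one>\<^bsub>G\<^esub>\<rparr>)" by (rule iso_imp_img_group[OF iso])
  then have "group H" by (simp add: H_def)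
  then show ?thesis using that iso assms(2) by (auto simp: H_def)
qed

theorem theorem1p1:
  fixes n :: nat and GK :: "(nat + nat) diagram"
  assumes "n \<ge> 2" and "GK \<in> granny_knots"
  shows "(\<exists>H :: nat monoid. group H \<and> finite (carrier H) \<and>
      card (Hom (generalised_knot_group n GK) H)
        < card (Hom (generalised_knot_group n square_knot) H))
    \<and> \<not> generalised_knot_group n GK \<cong> generalised_knot_group n square_knot"
proof -
  let ?G = "generalised_knot_group n GK" and ?S = "generalised_knot_group n square_knot"
  obtain p :: nat where p: "prime p" "p > 64 ^ n" using bigger_prime by blast
  define m where "m = int p"
  have m: "prime m" "m > 64 ^ n"
    using p of_nat_less_iff[of "64 ^ n" p, where 'a = int] by (simp_all add: m_def)
  define W where "W = wreath_group (int n) m"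
  have "m > 1" using m(1) by (simp add: prime_gt_1_int)
  then interpret finite_group W
    unfolding W_def by (intro finite_group_wreath_group) (use assms(1) in auto)
  \<comment> \<open>The two granny knots give triples with equal signs, and the negative case
    reduces to the positive one by \<open>card_root_triples_Negative\<close>.\<close>
  have less: "card (Hom ?G W) < card (Hom ?S W)"
    using assms(2) wreath_group_separates[OF assms(1) m]
    by (auto simp: granny_knots_def square_knot_def card_Hom_connected_sum_trefoils[OF is_group]
        card_root_triples_Negative W_def[symmetric])
  obtain H :: "nat monoid" and f where H: "group H" "finite (carrier H)" and f: "f \<in> iso W H"
    using finite_group_iso_nat[OF is_group finite_carrier] by blast
  have "card (Hom ?G H) \<le> card (Hom ?G W)"
    using iso_set_sym[OF f] finite_Hom_generalised_knot_group[OF is_group finite_carrier]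
    by (intro card_Hom_le_inj[OF group_generalised_knot_group, of "inv_into (carrier W) f"]) (auto simp: iso_def bij_betw_def)
  also note less
  also have "card (Hom ?S W) \<le> card (Hom ?S H)"
    using f finite_Hom_generalised_knot_group[OF H]
    by (intro card_Hom_le_inj[OF group_generalised_knot_group, of f]) (auto simp: iso_def bij_betw_def)
  finally have "card (Hom ?G H) < card (Hom ?S H)" .
  moreover have "\<not> ?G \<cong> ?S"
  proof
    assume "?G \<cong> ?S"
    then obtain i where "i \<in> hom ?G ?S" "i ` carrier ?G = carrier ?S"
      by (auto simp: is_iso_def iso_def bij_betw_def)
    \<comment> \<open>Precomposition with an isomorphism would reverse the strict
      inequality.\<close>
    then have "card (Hom ?S W) \<le> card (Hom ?G W)"
      by (rule card_Hom_le_surj[OF group_generalised_knot_group]) (rule finite_Hom_generalised_knot_group[OF is_group finite_carrier])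
    then show False using less by simp
  qed
  ultimately show ?thesis using H by blast
qed

end
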